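(* Let $1/2<t<1$ and let $q>r\ge 0$ be fixed constants, and put $\delta=1-t$. Suppose that $M$ and $N_0$ are positive integers satisfying $$M\ge \max\left\{4^{\frac{1}{1-t}}\left(\frac{2(2t-1)}{1-t-\delta t}\right)^{\frac{2}{t(1-t)}},\ \left(50\left(\frac{11}{10}\right)^{t(2-t)}\right)^{\frac{2}{1-t}}\right\}$$ and $$\begin{aligned}N_0\ge \max\biggl\{&4752M^4,\ \frac{2r}{q((264M^2)^{\frac1t}-2)},\ (10q(2q)^tM)^{\frac{1}{1-t}},\ 2^{\frac{1}{1-t-\delta t}}\frac{q+r}{q},\\ &q^{-1}\left(\frac{q(1-t-\delta t)}{(q+r)^{t+\delta t}}\right)^{\frac{1}{1-t-\delta t}},\ \frac{1}{1-2^{-\frac{1}{2t-1}}},\\ &q^{-1}(2q(1-t-\delta t))^{\frac{2}{1-\delta}}\left(\frac{2}{q(2t-1)}\right)^{\frac{1+\delta}{1-\delta}}M^{\frac{2-\delta}{1-\delta}},\ q^{-1}\left(\frac{2}{q(2t-1)}\right)^{\frac{1}{2t-1}}\biggr\}.\end{aligned}$$ Then, for any positive integer $n_0\ge N_0$, squares of sidelength $(qn+r)^{-t}$ for $n\ge n_0$ can be packed perfectly into a square of area $\sum_{n=n_0}^{\infty}(qn+r)^{-2t}$.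
   Context: A finite or countably infinite family of squares in the plane is packed into a region $\Omega$ if they are all contained in $\Omega$ and have pairwise disjoint interiors; it is packed perfectly into $\Omega$ if moreover the family covers $\Omega$ up to a null set. "Squares of sidelength $s_n$ for $n\ge n_0$ can be packed perfectly into $\Omega$" means that one can place, for each integer $n\ge n_0$, one square of sidelength $s_n$ so that the resulting family is packed perfectly into $\Omega$. *)

theory Defs
  imports "HOL-Analysis.Analysis"
begin

text \<open>Squares are closed and non-degenerate, and may be rotated.\<close>

definition square_of_side :: "real \<Rightarrow> (real^2) set \<Rightarrow> bool" where
  "square_of_side s Q \<longleftrightarrow> s > 0 \<and>
     (\<exists>p u v. norm u = 1 \<and> norm v = 1 \<and> u \<bullet> v = 0 \<and>
        Q = {p + a *\<^sub>R u + b *\<^sub>R v | a b. a \<in> {0..s} \<and> b \<in> {0..s}})"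

definition planar_square :: "(real^2) set \<Rightarrow> bool" where
  "planar_square Q \<longleftrightarrow> (\<exists>s. square_of_side s Q)"

definition packed_into :: "('i \<Rightarrow> (real^2) set) \<Rightarrow> 'i set \<Rightarrow> (real^2) set \<Rightarrow> bool" where
  "packed_into Q I \<Omega> \<longleftrightarrow>
     countable I \<and> (\<forall>i\<in>I. planar_square (Q i) \<and> Q i \<subseteq> \<Omega>) \<and>
     disjoint_family_on (\<lambda>i. interior (Q i)) I"

definition perfectly_packed_into :: "('i \<Rightarrow> (real^2) set) \<Rightarrow> 'i set \<Rightarrow> (real^2) set \<Rightarrow> bool" where
  "perfectly_packed_into Q I \<Omega> \<longleftrightarrow>
     packed_into Q I \<Omega> \<and> negligible (\<Omega> - (\<Union>i\<in>I. Q i))"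

definition can_pack_perfectly :: "(nat \<Rightarrow> real) \<Rightarrow> nat \<Rightarrow> (real^2) set \<Rightarrow> bool" where
  "can_pack_perfectly s n\<^sub>0 \<Omega> \<longleftrightarrow>
     (\<exists>Q. (\<forall>n\<ge>n\<^sub>0. square_of_side (s n) (Q n)) \<and> perfectly_packed_into Q {n\<^sub>0..} \<Omega>)"

end

theory Submission imports Defs begin

text \<open>
  Since the areas agree, it suffices to place all the squares; perfection is then automatic.
  The squares are placed in batches (Tao's method).  The unused part of \<open>\<Omega>\<close> is kept as a finite
  list of rectangles, and the sum of \<open>min w h powr \<delta> * max w h\<close> over that list is controlled,
  where \<open>\<delta> = 1 - t\<close>.  A bound on this weighted perimeter, together with the known total area,
  forces some rectangle to have both sides at least \<open>M\<close> times the next sidelength.  A strip of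
  that rectangle, \<open>M\<close> squares high, is filled with an almost regular grid.  The
  squares touch along rows and along columns, so the decrease of the sidelengths only opens tiny
  pinwheel holes at the grid vertices.  The weighted perimeter thus grows by only about \<open>1 / M\<close>
  times that of the squares just placed, slowly enough for the bound to persist.
  By scaling one may take \<open>q = 1\<close>.
\<close>

text \<open>Two competing requirements confine \<delta>. Write \<open>z n = n + r / q\<close> and
  \<open>side n = z n powr - t\<close>. Rectangles narrower than \<open>M * side n\<close> have
  total area at most \<open>(M * side n) powr (1 - \<delta>)\<close> times their weighted perimeter.
  To keep this below the remaining area, of order \<open>z n powr (1 - 2 * t)\<close>, the weighted
  perimeter may be of order \<open>M powr (\<delta> - 1) * z n powr (1 - t - \<delta> * t)\<close>.
  Over a batch of \<open>k * M\<close> squares this allowance grows by the order of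
  \<open>k * M powr \<delta> * side n powr (1 + \<delta>)\<close>, whereas the leftovers of the
  batch cost a constant times \<open>k * side n powr (1 + \<delta>)\<close>. The powers of
  \<open>z n\<close> agree for every \<delta>, so everything hinges on the factor
  \<open>M powr \<delta>\<close>: it beats the constant for large \<open>M\<close> only if \<delta>
  > 0, and the allowance grows only if \<open>1 - t - \<delta> * t > 0\<close>. For \<delta> = 1 - t
  that exponent is \<open>(1 - t)\<^sup>2\<close>, so both hold for every t < 1.\<close>

section \<open>Axis-parallel rectangles and the weighted perimeter\<close>

type_synonym rect = "real \<times> real \<times> real \<times> real"

fun non_overlapping :: "rect \<Rightarrow> rect \<Rightarrow> bool" where
  "non_overlapping (x, y, w, h) (x', y', w', h') \<longleftrightarrow>
     x + w \<le> x' \<or> x' + w' \<le> x \<or> y + h \<le> y' \<or> y' + h' \<le> y"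

text \<open>Nonnegative sides are part of the relation, so lying in the outer square also certifies
  that a rectangle is genuine, though possibly degenerate.\<close>

fun subrect :: "rect \<Rightarrow> rect \<Rightarrow> bool" where
  "subrect (x, y, w, h) (x', y', w', h') \<longleftrightarrow>
     0 \<le> w \<and> 0 \<le> h \<and> x' \<le> x \<and> x + w \<le> x' + w' \<and> y' \<le> y \<and> y + h \<le> y' + h'"

fun rect_area :: "rect \<Rightarrow> real" where
  "rect_area (x, y, w, h) = w * h"

text \<open>Interpolates between the longer side (\<delta> = 0) and the area (\<delta> = 1) of a
  nondegenerate rectangle: for \<delta> in between, thin leftovers are cheap, and those of zero
  width cost nothing.\<close>

fun weighted_perimeter :: "real \<Rightarrow> rect \<Rightarrow> real" where
  "weighted_perimeter \<delta> (x, y, w, h) = min w h powr \<delta> * max w h"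

fun transpose_rect :: "rect \<Rightarrow> rect" where
  "transpose_rect (x, y, w, h) = (y, x, h, w)"

lemma non_overlapping_sym: "non_overlapping A B \<Longrightarrow> non_overlapping B A"
  by (cases A; cases B) auto

lemma non_overlapping_subrect:
  "non_overlapping R R' \<Longrightarrow> subrect A R \<Longrightarrow> subrect B R' \<Longrightarrow> non_overlapping A B"
  by (cases A; cases B; cases R; cases R') auto

lemma subrect_trans: "subrect A B \<Longrightarrow> subrect B C \<Longrightarrow> subrect A C"
  by (cases A; cases B; cases C) auto

lemma rect_area_nonneg: "subrect A B \<Longrightarrow> 0 \<le> rect_area A"
  by (cases A; cases B) auto

lemma transpose_rect_simps [simp]:
  "transpose_rect (transpose_rect A) = A"
  "non_overlapping (transpose_rect A) (transpose_rect B) = non_overlapping A B"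
  "subrect (transpose_rect A) (transpose_rect B) = subrect A B"
  "rect_area (transpose_rect A) = rect_area A"
  "weighted_perimeter \<delta> (transpose_rect A) = weighted_perimeter \<delta> A"
  by (cases A; cases B; auto simp: min.commute max.commute mult.commute)+

lemma weighted_perimeter_mono:
  assumes "subrect A B" "0 \<le> \<delta>"
  shows "weighted_perimeter \<delta> A \<le> weighted_perimeter \<delta> B"
proof (cases A; cases B)
  fix x y w h x' y' w' h' :: real
  assume A: "A = (x, y, w, h)" and B: "B = (x', y', w', h')"
  have "0 \<le> w" "0 \<le> h" "w \<le> w'" "h \<le> h'"
    using assms(1) by (auto simp: A B)
  then show ?thesis
    unfolding A B weighted_perimeter.simps using assms(2)
    by (intro mult_mono powr_mono2) auto
qed

lemma weighted_perimeter_le: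
  assumes "0 \<le> w" "0 \<le> h" "min w h \<le> c" "0 \<le> \<delta>"
  shows "weighted_perimeter \<delta> (x, y, w, h) \<le> c powr \<delta> * (w + h)"
  unfolding weighted_perimeter.simps using assms
  by (intro mult_mono powr_mono2) auto

lemma sorted_wrt_map_distinct:
  assumes "distinct xs" "\<And>x y. x \<in> set xs \<Longrightarrow> y \<in> set xs \<Longrightarrow> x \<noteq> y \<Longrightarrow> P (f x) (f y)"
  shows "sorted_wrt P (map f xs)"
  using assms by (induction xs) auto

section \<open>Geometry and area of the staggered grid\<close>

lemma sum_by_parts:
  fixes f g :: "nat \<Rightarrow> real"
  shows "(\<Sum>i<Suc k. (f (Suc i) - f i) * g i) =
     f (Suc k) * g k - f 0 * g 0 - (\<Sum>i<k. f (Suc i) * (g (Suc i) - g i))"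
  by (induction k) (simp_all add: algebra_simps)

text \<open>
  A grid of axis-parallel cells in which neighbouring cells of a row share a vertical line and
  neighbouring cells of a column share a horizontal line, but rows drift to the right as
  \<open>j\<close> grows and columns drift downwards as \<open>i\<close> grows.  The opposite signs of the two drifts
  turn each interior vertex into a small rectangular hole (\<open>Inr\<close>) surrounded by four cells
  (\<open>Inl\<close>) in a pinwheel.
\<close>

locale staggered_grid =
  fixes X Y :: "nat \<Rightarrow> nat \<Rightarrow> real" and k m :: nat and x\<^sub>0 y\<^sub>0 W H :: real
  assumes X_mono1: "i \<le> i' \<Longrightarrow> X i j \<le> X i' j" and X_mono2: "j \<le> j' \<Longrightarrow> X i j \<le> X i j'"
    and Y_mono2: "j \<le> j' \<Longrightarrow> Y i j \<le> Y i j'" and Y_anti1: "i \<le> i' \<Longrightarrow> Y i' j \<le> Y i j"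
    and X_first: "X 0 j = x\<^sub>0" and X_last: "X (Suc k) j = x\<^sub>0 + W"
    and Y_first: "Y i 0 = y\<^sub>0" and Y_last: "Y i (Suc m) = y\<^sub>0 + H"
begin

fun piece :: "(nat \<times> nat) + (nat \<times> nat) \<Rightarrow> rect" where
  "piece (Inl (i, j)) = (X i j, Y i j, X (Suc i) j - X i j, Y i (Suc j) - Y i j)"
| "piece (Inr (i, j)) =
     (X (Suc i) j, Y (Suc i) (Suc j), X (Suc i) (Suc j) - X (Suc i) j, Y i (Suc j) - Y (Suc i) (Suc j))"

lemma X_mono: "i \<le> i' \<Longrightarrow> j \<le> j' \<Longrightarrow> X i j \<le> X i' j'"
  using X_mono1 X_mono2 order_trans by metis

lemma Y_mono: "i' \<le> i \<Longrightarrow> j \<le> j' \<Longrightarrow> Y i j \<le> Y i' j'"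
  using Y_anti1 Y_mono2 order_trans by metis

text \<open>The signs of the drifts decide which coordinate separates: a cell in a later column lies
  to the right if its row is at least as high, and below otherwise.\<close>

lemma piece_cell_cell:
  assumes "(i, j) \<noteq> (i', j')" "i \<le> i'"
  shows "non_overlapping (piece (Inl (i, j))) (piece (Inl (i', j')))"
proof (cases "i = i'")
  case True
  then show ?thesis
    using assms Y_mono[of i' i' "Suc j" j'] Y_mono[of i' i' "Suc j'" j] by (cases j j' rule: linorder_cases) auto
next
  case False
  then show ?thesis
    using assms X_mono[of "Suc i" i' j j'] Y_mono[of i i' "Suc j'" j] by (cases "j \<le> j'") auto
qed

text \<open>The pinwheel seen from a hole: cells of the lower left quadrant end to its left, those
  of the upper left start above it, those of the lower right end below it, those of the upper right
  start to its right.\<close>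

lemma piece_cell_hole: "non_overlapping (piece (Inl (i', j'))) (piece (Inr (i, j)))"
proof (cases "i' \<le> i")
  case True
  then show ?thesis
    using X_mono[of "Suc i'" "Suc i" j' j] Y_mono[of i' i "Suc j" j'] by (cases "j' \<le> j") auto
next
  case False
  then show ?thesis
    using X_mono[of "Suc i" i' "Suc j" j'] Y_mono[of "Suc i" i' "Suc j'" "Suc j"]
    by (cases "j' \<le> j") auto
qed

lemma piece_hole_hole:
  assumes "(i, j) \<noteq> (i', j')" "i \<le> i'"
  shows "non_overlapping (piece (Inr (i, j))) (piece (Inr (i', j')))"
proof (cases "i = i'")
  case True
  then show ?thesis
    using assms X_mono[of "Suc i" "Suc i" "Suc j" j'] X_mono[of "Suc i" "Suc i" "Suc j'" j]
    by (cases j j' rule: linorder_cases) auto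
next
  case False
  then show ?thesis
    using assms X_mono[of "Suc i" "Suc i'" "Suc j" j'] Y_mono[of "Suc i" i' "Suc j'" "Suc j"]
    by (cases "Suc j \<le> j'") auto
qed

lemma piece_non_overlapping:
  assumes "p \<noteq> p'" shows "non_overlapping (piece p) (piece p')"
proof -
  have "non_overlapping (piece (Inl c)) (piece (Inl c'))" if "c \<noteq> c'" for c c'
    using that piece_cell_cell non_overlapping_sym by (metis nat_le_linear surj_pair)
  moreover have "non_overlapping (piece (Inr c)) (piece (Inr c'))" if "c \<noteq> c'" for c c'
    using that piece_hole_hole non_overlapping_sym by (metis nat_le_linear surj_pair)
  moreover have "non_overlapping (piece (Inl c)) (piece (Inr c'))" for c c'
    using piece_cell_hole by (metis surj_pair)
  ultimately show ?thesis
    using assms non_overlapping_sym by (cases p; cases p') auto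
qed

lemma cell_subrect:
  assumes "i \<le> k" "j \<le> m"
  shows "subrect (piece (Inl (i, j))) (x\<^sub>0, y\<^sub>0, W, H)"
  using assms X_mono1[of 0 i j] X_mono1[of i "Suc i" j] X_mono1[of "Suc i" "Suc k" j]
    Y_mono2[of 0 j i] Y_mono2[of j "Suc j" i] Y_mono2[of "Suc j" "Suc m" i]
  by (auto simp: X_first X_last Y_first Y_last)

lemma hole_subrect:
  assumes "i < k" "j < m"
  shows "subrect (piece (Inr (i, j))) (x\<^sub>0, y\<^sub>0, W, H)"
  using assms X_mono1[of 0 "Suc i" j] X_mono2[of j "Suc j" "Suc i"]
    X_mono1[of "Suc i" "Suc k" "Suc j"] Y_mono2[of 0 "Suc j" "Suc i"]
    Y_anti1[of i "Suc i" "Suc j"] Y_mono2[of "Suc j" "Suc m" i]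
  by (auto simp: X_first X_last Y_first Y_last)

text \<open>Two summations by parts. The one in \<open>i\<close> turns the cells into
  \<open>W * H\<close> plus a sum of the drifts \<open>e\<close>; the one in \<open>j\<close> turns
  that sum into minus the holes, without boundary terms because \<open>e i 0\<close> and
  \<open>e i (Suc m)\<close> vanish. This identity stands in for an argument that the pieces cover
  the strip.\<close>

lemma area_pieces:
  "(\<Sum>i<Suc k. \<Sum>j<Suc m. rect_area (piece (Inl (i, j)))) +
   (\<Sum>i<k. \<Sum>j<m. rect_area (piece (Inr (i, j)))) = W * H"
proof -
  define g where "g j i = Y i (Suc j) - Y i j" for i j
  define e where "e i j = Y i j - Y (Suc i) j" for i j
  have tele: "(\<Sum>j<Suc m. g j i) = H" for i
    unfolding g_def by (simp add: sum_lessThan_telescope Y_first Y_last del: sum.lessThan_Suc)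
  have ge: "g j (Suc i) - g j i = - (e i (Suc j) - e i j)" for i j
    by (simp add: g_def e_def)
  have cells: "(\<Sum>j<Suc m. \<Sum>i<Suc k. (X (Suc i) j - X i j) * g j i) =
      W * H + (\<Sum>i<k. \<Sum>j<Suc m. (e i (Suc j) - e i j) * X (Suc i) j)"
  proof -
    have "(\<Sum>j<Suc m. \<Sum>i<Suc k. (X (Suc i) j - X i j) * g j i) =
        (\<Sum>j<Suc m. (x\<^sub>0 + W) * g j k - x\<^sub>0 * g j 0 +
           (\<Sum>i<k. (e i (Suc j) - e i j) * X (Suc i) j))"
      by (intro sum.cong refl, subst sum_by_parts)
         (simp add: X_first X_last ge sum_subtractf algebra_simps del: sum.lessThan_Suc)
    also have "\<dots> = (x\<^sub>0 + W) * (\<Sum>j<Suc m. g j k) - x\<^sub>0 * (\<Sum>j<Suc m. g j 0) +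
        (\<Sum>i<k. \<Sum>j<Suc m. (e i (Suc j) - e i j) * X (Suc i) j)"
      by (simp only: sum.distrib sum_subtractf sum_distrib_left sum.swap[where A = "{..<Suc m}"])
    finally show ?thesis by (simp only: tele) (simp add: algebra_simps)
  qed
  have holes: "(\<Sum>j<Suc m. (e i (Suc j) - e i j) * X (Suc i) j) =
      - (\<Sum>j<m. (X (Suc i) (Suc j) - X (Suc i) j) * e i (Suc j))" for i
    by (subst sum_by_parts) (simp add: e_def Y_first Y_last mult.commute)
  have "(\<Sum>j<Suc m. \<Sum>i<Suc k. (X (Suc i) j - X i j) * g j i) =
      W * H - (\<Sum>i<k. \<Sum>j<m. (X (Suc i) (Suc j) - X (Suc i) j) * e i (Suc j))"
    unfolding cells holes sum_negf by simp
  then show ?thesis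
    by (subst sum.swap) (simp add: g_def e_def del: sum.lessThan_Suc)
qed

end

section \<open>Filling one strip and the cost of its leftovers\<close>

lemma sum_list_map_le:
  assumes "\<And>x. x \<in> set xs \<Longrightarrow> f x \<le> (c :: real)"
  shows "sum_list (map f xs) \<le> real (length xs) * c"
  using assms by (induction xs) (auto simp: algebra_simps add_mono)

lemma member_le_sum_list_map:
  fixes f :: "'a \<Rightarrow> real"
  assumes "\<forall>x\<in>set xs. 0 \<le> f x" "x \<in> set xs"
  shows "f x \<le> sum_list (map f xs)"
  using assms by (metis (no_types, lifting) image_eqI image_iff list.set_map member_le_sum_list)

lemma sum_lessThan_le:
  assumes "\<And>i. i < n \<Longrightarrow> f i \<le> (c :: real)" "n \<le> n'" "0 \<le> c"
  shows "(\<Sum>i<n. f i) \<le> real n' * c"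
proof -
  have "(\<Sum>i<n. f i) \<le> real (card {..<n}) * c"
    using assms(1) by (intro sum_bounded_above) auto
  also have "\<dots> \<le> real n' * c"
    using assms by (simp add: mult_right_mono)
  finally show ?thesis .
qed

text \<open>Rows run along the shorter side \<open>w\<close>, so a strip of height at most
  \<open>M * s \<le> h\<close> fits, and what lies beyond it is one subrectangle that costs no more
  than the original. The added cost is proportional to \<open>k\<close> and not to
  \<open>k * M\<close>: there are only \<open>M + k + 1\<close> leftover cells,
  \<open>M \<le> k\<close>, and the \<open>k * M\<close> holes are small because \<open>b\<close>
  falls by at most \<open>s / z\<close> per index.\<close>

lemma pack_strip:
  fixes b :: "nat \<Rightarrow> real" and M k :: nat
  assumes \<delta>: "0 < \<delta>" "\<delta> \<le> 1" and s: "0 < s" "b 0 = s" and z: "real M ^ 3 \<le> z" "real k * real M \<le> z"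
    and M: "1 \<le> M" and b_pos: "\<And>p. 0 < b p"
    and b_anti: "\<And>p p'. p \<le> p' \<Longrightarrow> b p' \<le> b p"
    and b_diff: "\<And>p d. b p - b (p + d) \<le> real d * (s / z)"
    and w: "real M * s \<le> w" "w \<le> h" and k: "k = nat \<lfloor>w / s\<rfloor>"
  shows "\<exists>S T. length S = k * M \<and> (\<forall>p<k * M. \<exists>x y. S ! p = (x, y, b p, b p)) \<and>
    sorted_wrt non_overlapping (S @ T) \<and> (\<forall>A\<in>set (S @ T). subrect A (x, y, w, h)) \<and>
    sum_list (map rect_area (S @ T)) = w * h \<and>
    sum_list (map (weighted_perimeter \<delta>) T) \<le> weighted_perimeter \<delta> (x, y, w, h) +
      real k * (s powr \<delta> * s) * (8 + 5 * (real k * (real M)\<^sup>2 / z))"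
proof -
  \<comment> \<open>Squares are numbered down each column from the top, column after column, so
    \<open>a\<close> decreases in \<open>i\<close> and increases in \<open>j\<close>; this produces
    the two opposite drifts. At \<open>j = M\<close> the truncated subtraction repeats row
    \<open>M - 1\<close>, so the holes below the top leftovers have zero width.\<close>
  define a where "a i j = b (i * M + (M - 1 - j))" for i j
  \<comment> \<open>Column 0 has the largest squares and is the tallest. The alternatives
    \<open>x + w\<close> and \<open>y + H\<close> below stretch the cells with \<open>i = k\<close>
    or \<open>j = M\<close> to the border; these become the leftovers on the right and on
    top.\<close>
  define H where "H = (\<Sum>j<M. a 0 j)"
  define X where "X i j = (if i \<le> k then x + (\<Sum>i'<i. a i' j) else x + w)" for i j
  define Y where "Y i j = (if j \<le> M then y + (\<Sum>j'<j. a i j') else y + H)" for i j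
  have z0: "0 < z"
    using z(1) M by (meson less_le_trans of_nat_0_less_iff zero_less_power less_le_trans zero_less_one)
  have b_le: "b p \<le> s" for p
    using b_anti[of 0 p] s by simp
  have a_pos: "0 < a i j" and a_le: "a i j \<le> s" for i j
    using b_pos b_le by (auto simp: a_def)
  have w0: "0 < w"
    using w(1) s(1) M by (smt (verit) mult_pos_pos of_nat_0_less_iff not_one_le_zero gr0I)
  have ks: "real k * s \<le> w" "w < (real k + 1) * s"
  proof -
    have "real k = of_int \<lfloor>w / s\<rfloor>"
      unfolding k using w0 s by (simp add: zero_le_divide_iff)
    then have "real k \<le> w / s" "w / s < real k + 1"
      by linarith+
    then show "real k * s \<le> w" "w < (real k + 1) * s"
      using s by (simp_all add: field_simps)
  qed
  have kM: "M \<le> k"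
  proof -
    have "real M \<le> w / s"
      using w s by (simp add: field_simps)
    then show ?thesis unfolding k by (simp add: le_nat_floor)
  qed
  have a_anti1: "a i' j \<le> a i j" if "i \<le> i'" for i i' j
    unfolding a_def using that by (intro b_anti add_mono mult_right_mono) auto
  have a_mono2: "a i j \<le> a i j'" if "j \<le> j'" for i j j'
    unfolding a_def using that by (intro b_anti) auto
  have sum_a_le: "(\<Sum>i<n. a i j) \<le> real n * s" "(\<Sum>j<n. a i j) \<le> real n * s" for n i j
    using a_le s sum_lessThan_le[of n _ s n] by auto

  interpret staggered_grid X Y k M x y w H
  proof
    fix i i' j j' :: nat
    show "X i j \<le> X i' j" if "i \<le> i'"
    proof (cases "i' \<le> k")
      case True
      then show ?thesis
        using that a_pos by (auto simp: X_def less_imp_le intro!: sum_mono2)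
    next
      case False
      have "(\<Sum>i'<i. a i' j) \<le> w" if "i \<le> k"
        using sum_a_le(1)[where n = i and j = j] ks(1) that s mult_right_mono[of "real i" "real k" s] by linarith
      then show ?thesis using False by (auto simp: X_def)
    qed
    show "X i j \<le> X i j'" if "j \<le> j'"
      using that by (auto simp: X_def intro!: sum_mono a_mono2)
    show "Y i j \<le> Y i j'" if "j \<le> j'"
    proof (cases "j' \<le> M")
      case True
      then show ?thesis
        using that a_pos by (auto simp: Y_def less_imp_le intro!: sum_mono2)
    next
      case False
      have "(\<Sum>j'<j. a i j') \<le> H" if "j \<le> M"
      proof -
        have "(\<Sum>j'<j. a i j') \<le> (\<Sum>j'<M. a i j')"
          using that a_pos by (auto simp: less_imp_le intro!: sum_mono2)
        also have "\<dots> \<le> H"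
          unfolding H_def by (intro sum_mono a_anti1) auto
        finally show ?thesis .
      qed
      then show ?thesis using False by (auto simp: Y_def)
    qed
    show "Y i' j \<le> Y i j" if "i \<le> i'"
      using that by (auto simp: Y_def intro!: sum_mono a_anti1)
  qed (auto simp: X_def Y_def)

  have H_le: "H \<le> h"
    using sum_a_le(2)[where n = M and i = 0] w by (simp add: H_def)
  have H0: "0 \<le> H"
    unfolding H_def using a_pos by (simp add: sum_nonneg less_imp_le)
  define Sidx where "Sidx = map (\<lambda>p. Inl (p div M, M - 1 - p mod M) :: (nat \<times> nat) + (nat \<times> nat)) [0..<k * M]"
  define right where "right = map (\<lambda>j. Inl (k, j) :: (nat \<times> nat) + (nat \<times> nat)) [0..<M]"
  define top where "top = map (\<lambda>i. Inl (i, M) :: (nat \<times> nat) + (nat \<times> nat)) [0..<k]"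
  define holes where "holes = map (Inr :: _ \<Rightarrow> (nat \<times> nat) + (nat \<times> nat)) (List.product [0..<k] [0..<M])"
  define idx where "idx = Sidx @ right @ top @ [Inl (k, M)] @ holes"
  define rest where "rest = (x, y + H, w, h - H)"
  define S where "S = map piece Sidx"
  define T where "T = map piece (right @ top @ [Inl (k, M)] @ holes) @ [rest]"
  have ST: "S @ T = map piece idx @ [rest]"
    by (simp add: S_def T_def idx_def)

  have set_Sidx: "set Sidx = Inl ` ({..<k} \<times> {..<M})"
  proof (intro subset_antisym subsetI)
    fix c assume "c \<in> set Sidx"
    then show "c \<in> Inl ` ({..<k} \<times> {..<M})"
      using M by (auto simp: Sidx_def less_mult_imp_div_less)
  next
    fix c :: "(nat \<times> nat) + (nat \<times> nat)" assume "c \<in> Inl ` ({..<k} \<times> {..<M})"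
    then obtain i j where c: "c = Inl (i, j)" "i < k" "j < M" by auto
    define j' where "j' = M - 1 - j"
    have j': "j' < M" "j = M - 1 - j'" using c M by (auto simp: j'_def)
    have "i * M + j' < Suc i * M" using j' by simp
    also have "\<dots> \<le> k * M" using c by (intro mult_right_mono) auto
    finally have "i * M + j' < k * M" .
    moreover have "(i * M + j') div M = i" "(i * M + j') mod M = j'"
      using j' by simp_all
    ultimately show "c \<in> set Sidx"
      unfolding Sidx_def c j'(2) by (force intro!: image_eqI[of _ _ "i * M + j'"])
  qed
  have "distinct Sidx"
  proof -
    have "inj_on (\<lambda>p. Inl (p div M, M - 1 - p mod M) :: (nat \<times> nat) + (nat \<times> nat)) {0..<k * M}"
    proof (intro inj_onI)
      fix p p' assume "(Inl (p div M, M - 1 - p mod M) :: (nat \<times> nat) + (nat \<times> nat)) =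
        Inl (p' div M, M - 1 - p' mod M)"
      then have "p div M = p' div M" "M - 1 - p mod M = M - 1 - p' mod M" by auto
      moreover have "p mod M \<le> M - 1" "p' mod M \<le> M - 1"
        using M by (metis Suc_le_eq One_nat_def Suc_pred less_Suc_eq_le mod_less_divisor)+
      ultimately have "p div M = p' div M" "p mod M = p' mod M" by linarith+
      then show "p = p'" by (metis div_mult_mod_eq)
    qed
    then show ?thesis by (simp add: Sidx_def distinct_map)
  qed
  then have dist: "distinct idx"
    unfolding idx_def distinct_append set_Sidx
    by (auto simp: right_def top_def holes_def distinct_map inj_on_def distinct_product)
  have set_idx: "set idx = Inl ` ({..<Suc k} \<times> {..<Suc M}) \<union> Inr ` ({..<k} \<times> {..<M})"
    unfolding idx_def set_append set_Sidx
    by (auto simp: right_def top_def holes_def image_iff less_Suc_eq)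
  have sub: "subrect (piece c) (x, y, w, H)" if "c \<in> set idx" for c
    using that cell_subrect hole_subrect unfolding set_idx by (auto simp del: piece.simps subrect.simps)

  have sorted: "sorted_wrt non_overlapping (S @ T)"
  proof -
    have "sorted_wrt non_overlapping (map piece idx)"
      using dist piece_non_overlapping by (intro sorted_wrt_map_distinct) auto
    moreover have "non_overlapping (piece c) rest" if "c \<in> set idx" for c
      by (rule non_overlapping_subrect[OF _ sub[OF that], of rest])
         (use H_le w0 in \<open>auto simp: rest_def\<close>)
    ultimately show ?thesis unfolding ST by (auto simp: sorted_wrt_append)
  qed
  have rest_sub: "subrect rest (x, y, w, h)"
    using H_le H0 w0 by (simp add: rest_def)
  have sub': "\<forall>A\<in>set (S @ T). subrect A (x, y, w, h)"
    unfolding ST using sub rest_sub H_le H0 w0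
    by (auto intro!: subrect_trans[OF sub])
  have area: "sum_list (map rect_area (S @ T)) = w * h"
  proof -
    have "sum_list (map rect_area (map piece idx)) = (\<Sum>c\<in>set idx. rect_area (piece c))"
      using dist by (simp add: sum_list_distinct_conv_sum_set o_def)
    also have "\<dots> = (\<Sum>c\<in>{..<Suc k} \<times> {..<Suc M}. rect_area (piece (Inl c))) +
        (\<Sum>c\<in>{..<k} \<times> {..<M}. rect_area (piece (Inr c)))"
      unfolding set_idx by (subst sum.union_disjoint) (auto simp: sum.reindex)
    also have "\<dots> = w * H"
      using area_pieces by (simp only: sum.cartesian_product case_prod_unfold prod.collapse)
    finally show ?thesis unfolding ST by (simp add: rest_def algebra_simps)
  qed
  have nth_S: "\<forall>p<k * M. \<exists>x y. S ! p = (x, y, b p, b p)"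
  proof (intro allI impI)
    fix p assume p: "p < k * M"
    define i j where "i = p div M" and "j = M - 1 - p mod M"
    have i: "i < k" and j: "j < M"
      using p M by (auto simp: i_def j_def less_mult_imp_div_less)
    have "p mod M \<le> M - 1"
      using M by (metis One_nat_def Suc_pred less_Suc_eq_le less_le_trans mod_less_divisor zero_less_one)
    then have "M - 1 - j = p mod M"
      unfolding j_def by linarith
    then have "a i j = b p"
      unfolding a_def i_def by (simp only: div_mult_mod_eq)
    moreover have "S ! p = piece (Inl (i, j))"
      using p by (simp add: S_def Sidx_def i_def j_def)
    ultimately show "\<exists>x y. S ! p = (x, y, b p, b p)"
      using i j by (simp add: X_def Y_def)
  qed

  define E where "E = s powr \<delta> * s"
  \<comment> \<open>\<eta> bounds the relative decrease of the sidelength over the whole batch, and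
    \<open>\<theta> = M * \<eta>\<close> the resulting shortfall in height of a column, in units of
    \<open>s\<close>.\<close>
  define \<eta> where "\<eta> = real k * real M / z"
  define \<theta> where "\<theta> = real k * (real M)\<^sup>2 / z"
  have E0: "0 \<le> E" using s by (simp add: E_def)
  have \<eta>: "0 \<le> \<eta>" "\<eta> \<le> 1"
    using z z0 by (auto simp: \<eta>_def)
  have \<theta>: "0 \<le> \<theta>" "\<theta> = real M * \<eta>"
    using z0 by (auto simp: \<theta>_def \<eta>_def power2_eq_square)
  have M2: "(real M)\<^sup>2 \<le> z"
    using z(1) M power_increasing[of 2 3 "real M"] by simp
  have hole_cost: "weighted_perimeter \<delta> (piece c) \<le> E * (real k / z + (real M)\<^sup>2 / z)" if c': "c \<in> set holes" for c
  proof -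
    obtain i j where c: "c = Inr (i, j)" "i < k" "j < M"
      using c' by (auto simp: holes_def)
    have "(\<Sum>i'<Suc i. a i' (Suc j) - a i' j) \<le> real k * (s / z)"
    proof (intro sum_lessThan_le)
      fix i'
      \<comment> \<open>Vertical neighbours have consecutive numbers; the first alternative is the
        case \<open>j = M - 1\<close>, where row \<open>M\<close> repeats row
        \<open>M - 1\<close>.\<close>
      have "i' * M + (M - 1 - j) = i' * M + (M - 1 - Suc j) \<or>
        i' * M + (M - 1 - j) = i' * M + (M - 1 - Suc j) + 1" by linarith
      then show "a i' (Suc j) - a i' j \<le> s / z"
        unfolding a_def using b_diff[of "i' * M + (M - 1 - Suc j)" 1] s z0 by auto
    qed (use c s z0 in auto)
    then have dx: "X (Suc i) (Suc j) - X (Suc i) j \<le> s * (real k / z)"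
      using c by (simp add: X_def sum_subtractf mult.commute del: sum.lessThan_Suc)
    \<comment> \<open>Horizontal neighbours are \<open>M\<close> apart in the numbering and at most
      \<open>M\<close> rows accumulate, whence the square of \<open>M\<close>.\<close>
    have "(\<Sum>j'<Suc j. a i j' - a (Suc i) j') \<le> real M * (real M * (s / z))"
    proof (intro sum_lessThan_le)
      fix j'
      show "a i j' - a (Suc i) j' \<le> real M * (s / z)"
        unfolding a_def using b_diff[of "i * M + (M - 1 - j')" M] by (simp add: algebra_simps)
    qed (use c s z0 in auto)
    then have dy: "Y i (Suc j) - Y (Suc i) (Suc j) \<le> s * ((real M)\<^sup>2 / z)"
      using c by (simp add: Y_def sum_subtractf power2_eq_square mult_ac del: sum.lessThan_Suc)
    also have "\<dots> \<le> s * 1"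
      using M2 z0 s by (intro mult_left_mono) auto
    finally have "weighted_perimeter \<delta> (piece c) \<le> s powr \<delta> *
        ((X (Suc i) (Suc j) - X (Suc i) j) + (Y i (Suc j) - Y (Suc i) (Suc j)))"
      unfolding c piece.simps using X_mono2[of j "Suc j" "Suc i"] Y_anti1[of i "Suc i" "Suc j"] \<delta>
      by (intro weighted_perimeter_le) auto
    also have "\<dots> \<le> s powr \<delta> * (s * (real k / z) + s * ((real M)\<^sup>2 / z))"
      using dx dy by (intro mult_left_mono) auto
    finally show ?thesis by (simp add: E_def algebra_simps)
  qed
  have right_width: "X (Suc k) j - X k j \<le> s * (1 + real k * \<eta>)" for j
  proof -
    have "s - a i j \<le> s * \<eta>" if "i < k" for i
    proof -
      have "i * M + (M - 1 - j) \<le> Suc i * M" by simp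
      also have "\<dots> \<le> k * M" using that by (intro mult_right_mono) auto
      finally have "real (i * M + (M - 1 - j)) \<le> real k * real M"
        by (metis of_nat_le_iff of_nat_mult)
      then have "real (i * M + (M - 1 - j)) * (s / z) \<le> real k * real M * (s / z)"
        using s z0 by (intro mult_right_mono) auto
      then show ?thesis
        unfolding a_def using b_diff[of 0 "i * M + (M - 1 - j)"] s(2) by (simp add: \<eta>_def mult_ac)
    qed
    then have "(\<Sum>i<k. s - a i j) \<le> real k * (s * \<eta>)"
      using s \<eta> by (intro sum_lessThan_le) auto
    then show ?thesis
      using ks(2) by (simp add: X_def sum_subtractf algebra_simps)
  qed
  have top_height: "Y i (Suc M) - Y i M \<le> s * \<theta>" if "i \<le> k" for i
  proof -
    have "(\<Sum>j<M. a 0 j - a i j) \<le> real M * (s * \<eta>)"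
    proof (intro sum_lessThan_le)
      fix j
      have "real (i * M) * (s / z) \<le> real k * real M * (s / z)"
        using that s z0 by (intro mult_right_mono) (auto intro: mult_right_mono)
      then show "a 0 j - a i j \<le> s * \<eta>"
        unfolding a_def using b_diff[of "M - 1 - j" "i * M"] by (simp add: \<eta>_def mult_ac add.commute)
    qed (use s \<eta> in auto)
    then show ?thesis
      by (simp add: Y_def H_def sum_subtractf \<theta> mult_ac)
  qed
  have right_cost: "weighted_perimeter \<delta> (piece c) \<le> E * (2 + real k * \<eta>)" if c': "c \<in> set right" for c
  proof -
    obtain j where c: "c = Inl (k, j)" "j < M"
      using c' by (auto simp: right_def)
    have dy: "Y k (Suc j) - Y k j = a k j"
      using c by (simp add: Y_def)
    have "weighted_perimeter \<delta> (piece c) \<le> s powr \<delta> * ((X (Suc k) j - X k j) + (Y k (Suc j) - Y k j))"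
      unfolding c piece.simps using X_mono1[of k "Suc k" j] a_pos[of k j] a_le[of k j] \<delta>
      by (intro weighted_perimeter_le) (auto simp: dy)
    also have "\<dots> \<le> s powr \<delta> * (s * (1 + real k * \<eta>) + s)"
      using right_width a_le by (intro mult_left_mono add_mono) (auto simp: dy)
    finally show ?thesis by (simp add: E_def algebra_simps)
  qed
  have top_cost: "weighted_perimeter \<delta> (piece c) \<le> E * (1 + \<theta>)" if c': "c \<in> set top" for c
  proof -
    obtain i where c: "c = Inl (i, M)" "i < k"
      using c' by (auto simp: top_def)
    have dx: "X (Suc i) M - X i M = a i M"
      using c by (simp add: X_def)
    have "weighted_perimeter \<delta> (piece c) \<le> s powr \<delta> * ((X (Suc i) M - X i M) + (Y i (Suc M) - Y i M))"
      unfolding c piece.simps using Y_mono2[of M "Suc M" i] a_pos[of i M] a_le[of i M] \<delta>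
      by (intro weighted_perimeter_le) (auto simp: dx)
    also have "\<dots> \<le> s powr \<delta> * (s + s * \<theta>)"
      using top_height[of i] c a_le by (intro mult_left_mono add_mono) (auto simp: dx)
    finally show ?thesis by (simp add: E_def algebra_simps)
  qed
  \<comment> \<open>In the corner the shortfalls in both directions meet, and its height is
    controlled only by \<open>s * \<theta>\<close>, which may exceed \<open>s\<close>. Hence the
    base \<open>(1 + \<theta>) * s\<close>, whose first factor comes out linearly because \<delta>
    \<le> 1.\<close>
  have corner_cost: "weighted_perimeter \<delta> (piece (Inl (k, M))) \<le> E * ((1 + \<theta>) * (1 + real k * \<eta> + \<theta>))"
  proof -
    have "s * \<theta> \<le> (1 + \<theta>) * s" using s by (simp add: algebra_simps)
    then have "Y k (Suc M) - Y k M \<le> (1 + \<theta>) * s"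
      using top_height[of k] by simp
    then have "weighted_perimeter \<delta> (piece (Inl (k, M))) \<le>
        ((1 + \<theta>) * s) powr \<delta> * ((X (Suc k) M - X k M) + (Y k (Suc M) - Y k M))"
      unfolding piece.simps using X_mono1[of k "Suc k" M] Y_mono2[of M "Suc M" k] \<delta>
      by (intro weighted_perimeter_le) auto
    also have "\<dots> \<le> ((1 + \<theta>) powr 1 * s powr \<delta>) * (s * (1 + real k * \<eta>) + s * \<theta>)"
      using right_width[of M] top_height[of k] X_mono1[of k "Suc k" M] Y_mono2[of M "Suc M" k] \<theta> \<delta> s
      unfolding powr_mult[of "1 + \<theta>" s]
      by (intro mult_mono add_mono mult_right_mono powr_mono add_nonneg_nonneg mult_nonneg_nonneg) auto
    finally show ?thesis
      using \<theta> by (simp add: E_def algebra_simps)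
  qed
  have "sum_list (map (weighted_perimeter \<delta>) T) - weighted_perimeter \<delta> rest \<le>
      real M * (E * (2 + real k * \<eta>)) + real k * (E * (1 + \<theta>)) + E * ((1 + \<theta>) * (1 + real k * \<eta> + \<theta>)) +
      real (k * M) * (E * (real k / z + (real M)\<^sup>2 / z))"
    using sum_list_map_le[of right "\<lambda>c. weighted_perimeter \<delta> (piece c)", OF right_cost]
      sum_list_map_le[of top "\<lambda>c. weighted_perimeter \<delta> (piece c)", OF top_cost]
      sum_list_map_le[of holes "\<lambda>c. weighted_perimeter \<delta> (piece c)", OF hole_cost] corner_cost
    by (simp add: T_def o_def right_def top_def holes_def del: piece.simps)
  also have "\<dots> = E * (real M * (2 + real k * \<eta>) + real k * (1 + \<theta>) + (1 + \<theta>) * (1 + real k * \<eta> + \<theta>) +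
      real (k * M) * (real k / z + (real M)\<^sup>2 / z))"
    by (simp add: algebra_simps)
  \<comment> \<open>In the order right, top, corner, holes: 8 = 2 + 1 + 3 + 2 and 5 = 1 + 1 + 3 + 0.
    Everything becomes a multiple of \<open>k\<close> through \<open>M \<le> k\<close>,
    \<open>\<eta> \<le> 1\<close> and \<open>M * \<eta> = \<theta>\<close>.\<close>
  also have "\<dots> \<le> E * (real k * (8 + 5 * \<theta>))"
  proof (intro mult_left_mono E0)
    have k1: "1 \<le> real k" "real M \<le> real k" using kM M by simp_all
    have "real k * \<eta> \<le> real k" "\<theta> \<le> real k"
      using \<eta> k1 mult_left_mono[of \<eta> 1 "real k"] mult_left_mono[of \<eta> 1 "real M"] by (simp_all add: \<theta>)
    then have "1 + real k * \<eta> + \<theta> \<le> 3 * real k"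
      using k1 by linarith
    then have 1: "(1 + \<theta>) * (1 + real k * \<eta> + \<theta>) \<le> (1 + \<theta>) * (3 * real k)"
      using \<theta>(1) by (intro mult_left_mono) auto
    have "real M ^ 3 / z \<le> 1" using z z0 by simp
    then have "real k * \<eta> + real k * (real M ^ 3 / z) \<le> real k + real k"
      using \<open>real k * \<eta> \<le> real k\<close> mult_left_mono[of "real M ^ 3 / z" 1 "real k"] by simp
    then have 2: "real (k * M) * (real k / z + (real M)\<^sup>2 / z) \<le> 2 * real k"
      by (simp add: \<eta>_def algebra_simps power2_eq_square power3_eq_cube add_divide_distrib)
    have 3: "real M * (2 + real k * \<eta>) \<le> 2 * real k + real k * \<theta>"
      using k1 by (simp add: \<theta> algebra_simps)
    show "real M * (2 + real k * \<eta>) + real k * (1 + \<theta>) + (1 + \<theta>) * (1 + real k * \<eta> + \<theta>) +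
      real (k * M) * (real k / z + (real M)\<^sup>2 / z) \<le> real k * (8 + 5 * \<theta>)"
      using 1 2 3 by (simp add: algebra_simps)
  qed
  finally have "sum_list (map (weighted_perimeter \<delta>) T) \<le>
      weighted_perimeter \<delta> (x, y, w, h) + real k * E * (8 + 5 * \<theta>)"
    using weighted_perimeter_mono[OF rest_sub, of \<delta>] \<delta> by (simp add: mult_ac)
  moreover have "length S = k * M"
    by (simp add: S_def Sidx_def)
  ultimately show ?thesis
    using sorted sub' area nth_S unfolding E_def \<theta>_def by blast
qed

lemma pack_rect:
  fixes b :: "nat \<Rightarrow> real" and M k :: nat
  assumes \<delta>: "0 < \<delta>" "\<delta> \<le> 1" and s: "0 < s" "b 0 = s" and z: "real M ^ 3 \<le> z" "real k * real M \<le> z"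
    and M: "1 \<le> M" and b_pos: "\<And>p. 0 < b p"
    and b_anti: "\<And>p p'. p \<le> p' \<Longrightarrow> b p' \<le> b p"
    and b_diff: "\<And>p d. b p - b (p + d) \<le> real d * (s / z)"
    and w: "real M * s \<le> min w h" and k: "k = nat \<lfloor>min w h / s\<rfloor>"
  shows "\<exists>S T. length S = k * M \<and> (\<forall>p<k * M. \<exists>x y. S ! p = (x, y, b p, b p)) \<and>
    sorted_wrt non_overlapping (S @ T) \<and> (\<forall>A\<in>set (S @ T). subrect A (x, y, w, h)) \<and>
    sum_list (map rect_area (S @ T)) = w * h \<and>
    sum_list (map (weighted_perimeter \<delta>) T) \<le> weighted_perimeter \<delta> (x, y, w, h) +
      real k * (s powr \<delta> * s) * (8 + 5 * (real k * (real M)\<^sup>2 / z))"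
proof (cases "w \<le> h")
  case True
  then show ?thesis
    using w k by (intro pack_strip[OF \<delta> s z M b_pos b_anti b_diff]) auto
next
  case False
  then have "\<exists>S T. length S = k * M \<and> (\<forall>p<k * M. \<exists>x y. S ! p = (x, y, b p, b p)) \<and>
    sorted_wrt non_overlapping (S @ T) \<and> (\<forall>A\<in>set (S @ T). subrect A (y, x, h, w)) \<and>
    sum_list (map rect_area (S @ T)) = h * w \<and>
    sum_list (map (weighted_perimeter \<delta>) T) \<le> weighted_perimeter \<delta> (y, x, h, w) +
      real k * (s powr \<delta> * s) * (8 + 5 * (real k * (real M)\<^sup>2 / z))"
    using w k by (intro pack_strip[OF \<delta> s z M b_pos b_anti b_diff]) auto
  then obtain S T where ST: "length S = k * M" "\<forall>p<k * M. \<exists>x y. S ! p = (x, y, b p, b p)"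
    "sorted_wrt non_overlapping (S @ T)" "\<forall>A\<in>set (S @ T). subrect A (transpose_rect (x, y, w, h))"
    "sum_list (map rect_area (S @ T)) = w * h"
    "sum_list (map (weighted_perimeter \<delta>) T) \<le> weighted_perimeter \<delta> (transpose_rect (x, y, w, h)) +
      real k * (s powr \<delta> * s) * (8 + 5 * (real k * (real M)\<^sup>2 / z))"
    by (auto simp: mult.commute)
  define S' T' where "S' = map transpose_rect S" and "T' = map transpose_rect T"
  have ST': "S' @ T' = map transpose_rect (S @ T)"
    by (simp add: S'_def T'_def)
  have "\<exists>x y. S' ! p = (x, y, b p, b p)" if "p < k * M" for p
    using ST(1,2) that by (force simp: S'_def)
  moreover have "sorted_wrt non_overlapping (S' @ T')"
    unfolding ST' sorted_wrt_map using ST(3) by simp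
  moreover have "\<forall>A\<in>set (S' @ T'). subrect A (x, y, w, h)"
  proof
    fix A assume "A \<in> set (S' @ T')"
    then obtain B where "B \<in> set (S @ T)" "A = transpose_rect B"
      unfolding ST' by auto
    then show "subrect A (x, y, w, h)"
      using ST(4) transpose_rect_simps(1,3) by metis
  qed
  moreover have "sum_list (map rect_area (S' @ T')) = w * h"
    unfolding ST' map_map o_def transpose_rect_simps by (rule ST(5))
  moreover have "sum_list (map (weighted_perimeter \<delta>) T') \<le> weighted_perimeter \<delta> (x, y, w, h) +
      real k * (s powr \<delta> * s) * (8 + 5 * (real k * (real M)\<^sup>2 / z))"
    unfolding T'_def map_map o_def transpose_rect_simps using ST(6) unfolding transpose_rect_simps .
  ultimately show ?thesis
    using ST(1) by (intro exI[of _ S'] exI[of _ T']) (auto simp: S'_def)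
qed

section \<open>Mean value estimates for powers and for tails of power series\<close>

lemma powr_sub_one: "0 < (x :: real) \<Longrightarrow> x powr (c - 1) = x powr c / x"
  by (simp add: powr_diff)

lemma powr_minus_diff_le:
  fixes x y t :: real
  assumes "0 < x" "x \<le> y" "0 \<le> t" "t \<le> 1"
  shows "x powr - t - y powr - t \<le> (y - x) * (x powr - t / x)"
proof (cases "x = y")
  case False
  then have "\<exists>\<xi>>x. \<xi> < y \<and> y powr - t - x powr - t = (y - x) * (- t * \<xi> powr (- t - 1))"
    using assms False by (intro MVT2 has_real_derivative_powr) auto
  then obtain \<xi> where \<xi>: "x < \<xi>" "y powr - t - x powr - t = (y - x) * (- t * \<xi> powr (- t - 1))"
    by blast
  have "t * \<xi> powr (- t - 1) \<le> 1 * x powr (- t - 1)"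
    using assms \<xi> by (intro mult_mono powr_mono2') auto
  then have "(y - x) * (t * \<xi> powr (- t - 1)) \<le> (y - x) * x powr (- t - 1)"
    using assms by (intro mult_left_mono) auto
  then show ?thesis
    using \<xi>(2) assms by (simp add: powr_diff algebra_simps)
qed simp

text \<open>The condition \<open>d \<le> z\<close> keeps the intermediate point below
  \<open>2 * z\<close>, where the derivative is still at least half its value at \<open>z\<close>
  because the exponent exceeds -1.\<close>

lemma powr_add_diff_ge:
  fixes z d \<gamma> :: real
  assumes "0 < z" "0 < d" "d \<le> z" "0 < \<gamma>" "\<gamma> \<le> 1"
  shows "\<gamma> * d * z powr (\<gamma> - 1) / 2 \<le> (z + d) powr \<gamma> - z powr \<gamma>"
proof -
  have "\<exists>\<xi>>z. \<xi> < z + d \<and> (z + d) powr \<gamma> - z powr \<gamma> = (z + d - z) * (\<gamma> * \<xi> powr (\<gamma> - 1))"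
    using assms by (intro MVT2 has_real_derivative_powr) auto
  then obtain \<xi> where \<xi>: "z < \<xi>" "\<xi> < z + d" "(z + d) powr \<gamma> - z powr \<gamma> = d * (\<gamma> * \<xi> powr (\<gamma> - 1))"
    by auto
  have "z powr (\<gamma> - 1) / 2 = 2 powr (- 1) * z powr (\<gamma> - 1)"
    by (simp add: powr_minus)
  also have "\<dots> \<le> 2 powr (\<gamma> - 1) * z powr (\<gamma> - 1)"
    using assms by (intro mult_right_mono powr_mono) auto
  also have "\<dots> = (2 * z) powr (\<gamma> - 1)"
    using assms by (simp add: powr_mult)
  also have "\<dots> \<le> \<xi> powr (\<gamma> - 1)"
    using assms \<xi> by (intro powr_mono2') auto
  finally have "\<gamma> * d * (z powr (\<gamma> - 1) / 2) \<le> \<gamma> * d * \<xi> powr (\<gamma> - 1)"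
    using assms by (intro mult_left_mono) auto
  then show ?thesis using \<xi>(3) by (simp add: mult_ac)
qed

text \<open>The integral test in telescoping form: \<open>D i\<close> is the integral of the summand
  from \<open>z + i\<close> to infinity, and each difference lies between two consecutive
  terms.\<close>

lemma powr_tail_sum_bounds:
  fixes z \<tau> :: real
  assumes "0 < z" "0 < \<tau>"
  shows "summable (\<lambda>i. (z + real i) powr (- \<tau> - 1))"
    and "z powr - \<tau> / \<tau> \<le> (\<Sum>i. (z + real i) powr (- \<tau> - 1))"
    and "(\<Sum>i. (z + real i) powr (- \<tau> - 1)) \<le> z powr (- \<tau> - 1) + z powr - \<tau> / \<tau>"
proof -
  define D where "D i = (z + real i) powr - \<tau> / \<tau>" for i
  have D: "(z + real (Suc i)) powr (- \<tau> - 1) \<le> D i - D (Suc i)"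
    "D i - D (Suc i) \<le> (z + real i) powr (- \<tau> - 1)" for i
  proof -
    define x where "x = z + real i"
    have x: "0 < x" using assms by (simp add: x_def)
    have "\<exists>\<xi>>x. \<xi> < x + 1 \<and>
        (x + 1) powr - \<tau> - x powr - \<tau> = (x + 1 - x) * (- \<tau> * \<xi> powr (- \<tau> - 1))"
      using x by (intro MVT2 has_real_derivative_powr) auto
    then obtain \<xi> where \<xi>: "x < \<xi>" "\<xi> < x + 1"
      "(x + 1) powr - \<tau> - x powr - \<tau> = - \<tau> * \<xi> powr (- \<tau> - 1)"
      by auto
    have "D i - D (Suc i) = \<xi> powr (- \<tau> - 1)"
      using \<xi>(3) assms by (simp add: D_def x_def field_simps)
    moreover have "(x + 1) powr (- \<tau> - 1) \<le> \<xi> powr (- \<tau> - 1)"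
      "\<xi> powr (- \<tau> - 1) \<le> x powr (- \<tau> - 1)"
      using x \<xi> assms by (auto intro!: powr_mono2')
    ultimately show "(z + real (Suc i)) powr (- \<tau> - 1) \<le> D i - D (Suc i)"
      "D i - D (Suc i) \<le> (z + real i) powr (- \<tau> - 1)"
      by (simp_all add: x_def add_ac)
  qed
  have "(\<lambda>i. (z + real i) powr - \<tau> / \<tau>) \<longlonglongrightarrow> 0 / \<tau>"
    using assms
    by (intro tendsto_divide tendsto_neg_powr filterlim_tendsto_add_at_top[OF tendsto_const]
        filterlim_real_sequentially tendsto_const) auto
  then have sums: "(\<lambda>i. D i - D (Suc i)) sums (D 0 - 0)"
    by (intro telescope_sums') (simp add: D_def)
  have "summable (\<lambda>i. (z + real (Suc i)) powr (- \<tau> - 1))"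
    by (rule summable_comparison_test'[OF sums_summable[OF sums], of 0]) (use D(1) in auto)
  then show summ: "summable (\<lambda>i. (z + real i) powr (- \<tau> - 1))"
    by (subst (asm) summable_Suc_iff)
  have "(\<Sum>i. D i - D (Suc i)) \<le> (\<Sum>i. (z + real i) powr (- \<tau> - 1))"
    by (intro suminf_le D(2) sums_summable[OF sums] summ)
  then show "z powr - \<tau> / \<tau> \<le> (\<Sum>i. (z + real i) powr (- \<tau> - 1))"
    using sums_unique[OF sums] by (simp add: D_def)
  have "(\<Sum>i. (z + real (Suc i)) powr (- \<tau> - 1)) \<le> (\<Sum>i. D i - D (Suc i))"
    by (intro suminf_le D(1) sums_summable[OF sums])
       (use \<open>summable (\<lambda>i. (z + real (Suc i)) powr (- \<tau> - 1))\<close> in auto)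
  then show "(\<Sum>i. (z + real i) powr (- \<tau> - 1)) \<le> z powr (- \<tau> - 1) + z powr - \<tau> / \<tau>"
    using suminf_split_head[OF summ] sums_unique[OF sums] by (simp add: D_def)
qed

section \<open>The induction over batches, normalised to q = 1\<close>

text \<open>Here \<open>a\<close> stands for \<open>r / q\<close>. The conditions
  \<open>M_large\<close> yield the two halves of \<open>(8 + 5 * \<theta>) * (4 * (2 * t - 1)) \<le>
  (1 - t)\<^sup>2 * M powr (1 - t)\<close>, by which the cost of a batch stays below the growth of
  the bound; the half with \<theta> also uses the multiple of \<open>M ^ 4\<close> below
  \<open>n\<^sub>0\<close>. The last condition gives \<open>k * M \<le> z n\<close>, so that a batch
  at most doubles \<open>z n\<close>.\<close>

locale power_sidelengths =
  fixes t a :: real and M n\<^sub>0 :: nat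
  assumes t: "1/2 < t" "t < 1" and a: "0 \<le> a" and M: "1 \<le> M"
    and M_large: "64 * (2 * t - 1) \<le> (1 - t)\<^sup>2 * real M powr (1 - t)"
      "sqrt (2 * t - 1) \<le> (1 - t)\<^sup>2 * real M powr (1 - t)"
    and n\<^sub>0_large: "4752 * real M ^ 4 \<le> real n\<^sub>0" "2 * (real M)\<^sup>2 \<le> real n\<^sub>0 * (2 * t - 1)"
begin

definition z :: "nat \<Rightarrow> real" where "z n = real n + a"
definition side :: "nat \<Rightarrow> real" where "side n = z n powr - t"
definition tail_area :: "nat \<Rightarrow> real" where "tail_area n = (\<Sum>i. (side (n + i))\<^sup>2)"
text \<open>
  Chosen so that rectangles narrower than \<open>M * side n\<close> with at most this weighted perimeter have
  total area at most half of the lower bound for \<open>tail_area n\<close>.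
\<close>

definition perimeter_bound :: "nat \<Rightarrow> real" where
  "perimeter_bound n = real M powr - t * z n powr (1 - t)\<^sup>2 / (2 * (2 * t - 1))"

text \<open>That \<open>S\<close> and \<open>R\<close> exhaust the square is recorded only through
  the total area of \<open>R\<close>, which is all that the search for a wide rectangle
  requires.\<close>

definition packing_state :: "real \<Rightarrow> nat \<Rightarrow> rect list \<Rightarrow> rect list \<Rightarrow> bool" where
  "packing_state l N S R \<longleftrightarrow>
     length S = N \<and> (\<forall>p<N. \<exists>x y. S ! p = (x, y, side (n\<^sub>0 + p), side (n\<^sub>0 + p))) \<and>
     sorted_wrt non_overlapping (S @ R) \<and> (\<forall>A\<in>set (S @ R). subrect A (0, 0, l, l)) \<and>
     sum_list (map rect_area R) = tail_area (n\<^sub>0 + N) \<and>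
     sum_list (map (weighted_perimeter (1 - t)) R) \<le> perimeter_bound (n\<^sub>0 + N)"

lemma z_ge: "n\<^sub>0 \<le> n \<Longrightarrow> 4752 * real M ^ 4 \<le> z n" "n\<^sub>0 \<le> n \<Longrightarrow> 2 * (real M)\<^sup>2 \<le> z n * (2 * t - 1)"
proof -
  assume n: "n\<^sub>0 \<le> n"
  then show "4752 * real M ^ 4 \<le> z n"
    using n\<^sub>0_large a by (simp add: z_def)
  have "real n\<^sub>0 * (2 * t - 1) \<le> z n * (2 * t - 1)"
    using n a t by (intro mult_right_mono) (auto simp: z_def)
  then show "2 * (real M)\<^sup>2 \<le> z n * (2 * t - 1)"
    using n\<^sub>0_large by simp
qed

lemma M_pow_le_z: "n\<^sub>0 \<le> n \<Longrightarrow> i \<le> 4 \<Longrightarrow> 4752 * real M ^ i \<le> z n"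
  using z_ge(1)[of n] power_increasing[of i 4 "real M"] M by simp

lemma z_ge_1: "n\<^sub>0 \<le> n \<Longrightarrow> 1 \<le> z n"
  using M_pow_le_z[of n 0] by simp

lemma side_pos: "n\<^sub>0 \<le> n \<Longrightarrow> 0 < side n"
  using z_ge_1[of n] by (simp add: side_def)

lemma side_anti: "n\<^sub>0 \<le> n \<Longrightarrow> n \<le> n' \<Longrightarrow> side n' \<le> side n"
  using z_ge_1[of n] t by (auto simp: side_def z_def intro!: powr_mono2')

lemma side_diff:
  assumes "n\<^sub>0 \<le> n"
  shows "side (n + p) - side (n + (p + d)) \<le> real d * (side n / z n)"
proof -
  have "side (n + p) - side (n + (p + d)) \<le> (z (n + (p + d)) - z (n + p)) * (side (n + p) / z (n + p))"
    unfolding side_def using z_ge_1[of "n + p"] assms t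
    by (intro powr_minus_diff_le) (auto simp: z_def)
  also have "\<dots> \<le> real d * (side n / z n)"
    using z_ge_1[of n] side_anti[of n "n + p"] side_pos[of n] side_pos[of "n + p"] assms
    by (intro mult_mono frac_le divide_nonneg_pos) (auto simp: z_def)
  finally show ?thesis .
qed

lemma side_square: "(side n)\<^sup>2 = z n powr (- (2 * t - 1) - 1)"
  by (simp add: side_def power2_eq_square powr_add[symmetric])

lemma tail_area_summable: "n\<^sub>0 \<le> n \<Longrightarrow> summable (\<lambda>i. (side (n + i))\<^sup>2)"
  using powr_tail_sum_bounds(1)[of "z n" "2 * t - 1"] z_ge_1[of n] t
  by (simp add: side_square z_def algebra_simps)

lemma tail_area_bounds:
  assumes "n\<^sub>0 \<le> n"
  shows "z n powr - (2 * t - 1) / (2 * t - 1) \<le> tail_area n"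
    and "tail_area n \<le> 2 * z n powr - (2 * t - 1) / (2 * t - 1)"
proof -
  have z: "1 \<le> z n" using z_ge_1 assms by simp
  have eq: "tail_area n = (\<Sum>i. (z n + real i) powr (- (2 * t - 1) - 1))"
    unfolding tail_area_def side_square by (simp add: z_def algebra_simps)
  show "z n powr - (2 * t - 1) / (2 * t - 1) \<le> tail_area n"
    unfolding eq using z t by (intro powr_tail_sum_bounds) auto
  have "tail_area n \<le> z n powr (- (2 * t - 1) - 1) + z n powr - (2 * t - 1) / (2 * t - 1)"
    unfolding eq using z t by (intro powr_tail_sum_bounds) auto
  also have "z n powr (- (2 * t - 1) - 1) = z n powr - (2 * t - 1) / z n"
    using z by (intro powr_sub_one) simp
  also have "\<dots> \<le> z n powr - (2 * t - 1) / (2 * t - 1)"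
    using z t by (intro divide_left_mono) auto
  finally show "tail_area n \<le> 2 * z n powr - (2 * t - 1) / (2 * t - 1)" by simp
qed

lemma tail_area_split:
  assumes "n\<^sub>0 \<le> n"
  shows "tail_area n = (\<Sum>p<N. (side (n + p))\<^sup>2) + tail_area (n + N)"
  unfolding tail_area_def using suminf_split_initial_segment[OF tail_area_summable[OF assms], of N]
  by (simp add: add_ac)

text \<open>The cost of the whole square is \<open>(l\<^sup>2) powr ((2 - t) / 2)\<close>. Since
  \<open>- (2 * t - 1) * ((2 - t) / 2) + t / 2 = (1 - t)\<^sup>2\<close>, comparison with the bound
  leaves a spare factor \<open>Z powr (t / 2)\<close>, which must absorb
  \<open>4 * M powr t * T powr (t / 2)\<close>.\<close>

lemma packing_state_initial:
  assumes "0 < l" "l\<^sup>2 = tail_area n\<^sub>0"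
  shows "packing_state l 0 [] [(0, 0, l, l)]"
proof -
  define T where "T = 2 * t - 1"
  define Z where "Z = z n\<^sub>0"
  have T: "0 < T" "T < 1" using t by (auto simp: T_def)
  have Z: "1 \<le> Z" "4752 * (real M)\<^sup>2 \<le> Z"
    using z_ge_1[of n\<^sub>0] M_pow_le_z[of n\<^sub>0 2] by (auto simp: Z_def)
  have "l powr (1 - t) * l = l powr (2 - t)"
    using assms(1) powr_mult_base[of l "1 - t"] by (simp add: mult.commute)
  also have "\<dots> = (l\<^sup>2) powr ((2 - t) / 2)"
    using assms(1) by (simp add: powr_powr diff_divide_distrib flip: powr_numeral)
  also have "\<dots> \<le> (2 * Z powr - T / T) powr ((2 - t) / 2)"
    using tail_area_bounds[of n\<^sub>0] t unfolding assms(2) T_def Z_def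
    by (intro powr_mono2) (auto simp: tail_area_def intro!: suminf_nonneg tail_area_summable)
  also have "\<dots> = 2 powr ((2 - t) / 2) * Z powr (- T * ((2 - t) / 2)) / T powr ((2 - t) / 2)"
    using T Z by (simp add: powr_mult powr_divide powr_powr)
  also have "\<dots> \<le> 2 * Z powr (- T * ((2 - t) / 2)) / T powr ((2 - t) / 2)"
    using t T powr_mono[of "(2 - t) / 2" 1 2] by (intro divide_right_mono mult_right_mono) auto
  also have "\<dots> \<le> real M powr - t * Z powr (1 - t)\<^sup>2 / (2 * T)"
  proof -
    \<comment> \<open>As 256 is the fourth power of 4, its power \<open>t / 2\<close> is
      \<open>4 powr (2 * t)\<close>, which is at least 4 because t > 1/2.\<close>
    have "4 powr 1 \<le> 4 powr (4 * (t / 2) )" using t by (intro powr_mono) auto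
    also have "\<dots> = 256 powr (t / 2)"
      using powr_powr[of 4 4 "t / 2"] by (simp del: powr_powr)
    also have "\<dots> \<le> (Z / ((real M)\<^sup>2 * T)) powr (t / 2)"
    proof (intro powr_mono2)
      have "256 * ((real M)\<^sup>2 * T) \<le> 4752 * ((real M)\<^sup>2 * 1)"
        using T by (intro mult_mono) auto
      also have "\<dots> \<le> Z" using Z by simp
      finally show "256 \<le> Z / ((real M)\<^sup>2 * T)"
        using Z T M by (subst pos_le_divide_eq) auto
    qed (use t in auto)
    also have "\<dots> = Z powr (t / 2) / (real M powr t * T powr (t / 2))"
      using Z T M by (simp add: powr_mult powr_divide powr_powr flip: powr_numeral)
    finally have 4: "4 * (real M powr t * T powr (t / 2)) \<le> Z powr (t / 2)"
      using M T by (simp add: field_simps)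
    have "- T * ((2 - t) / 2) + t / 2 = (1 - t)\<^sup>2"
      by (simp add: T_def field_simps power2_eq_square)
    then have Zp: "Z powr (1 - t)\<^sup>2 = Z powr (- T * ((2 - t) / 2)) * Z powr (t / 2)"
      by (simp flip: powr_add)
    have Tp: "T = T powr ((2 - t) / 2) * T powr (t / 2)"
      using T by (simp flip: powr_add add: field_simps)
    have Mp: "real M powr - t * real M powr t = 1"
      using M by (simp flip: powr_add)
    have "2 * Z powr (- T * ((2 - t) / 2)) / T powr ((2 - t) / 2) =
      real M powr - t * Z powr (- T * ((2 - t) / 2)) * (4 * (real M powr t * T powr (t / 2))) /
        (2 * (T powr ((2 - t) / 2) * T powr (t / 2)))"
      using Mp T by (simp add: field_simps)
    also have "\<dots> \<le> real M powr - t * Z powr (- T * ((2 - t) / 2)) * Z powr (t / 2) /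
        (2 * (T powr ((2 - t) / 2) * T powr (t / 2)))"
      using 4 by (intro divide_right_mono mult_left_mono) auto
    also have "\<dots> = real M powr - t * Z powr (1 - t)\<^sup>2 / (2 * T)"
      unfolding Zp using Tp by simp
    finally show ?thesis .
  qed
  finally have "l powr (1 - t) * l \<le> perimeter_bound n\<^sub>0"
    by (simp add: perimeter_bound_def T_def Z_def)
  then show ?thesis
    using assms by (simp add: packing_state_def power2_eq_square)
qed

text \<open>An area is \<open>min w h powr t\<close> times the weighted perimeter, so narrowness
  bounds the total area. The exponents combine as
  \<open>- t * t + (1 - t)\<^sup>2 = - (2 * t - 1)\<close>, that of the tail; this fixes the
  exponent in \<open>perimeter_bound\<close>, and its factor 1/2 gives a strict
  contradiction.\<close>

lemma exists_wide_rect: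
  assumes "packing_state l N S R"
  shows "\<exists>x y w h. (x, y, w, h) \<in> set R \<and> real M * side (n\<^sub>0 + N) \<le> min w h"
proof (rule ccontr)
  assume neg: "\<not> ?thesis"
  define n where "n = n\<^sub>0 + N"
  define c where "c = (real M * side n) powr t"
  have z: "1 \<le> z n" using z_ge_1 by (simp add: n_def)
  have "rect_area A \<le> c * weighted_perimeter (1 - t) A" if A: "A \<in> set R" for A
  proof -
    obtain x y w h where A': "A = (x, y, w, h)" by (cases A) auto
    have "subrect A (0, 0, l, l)"
      using assms A by (auto simp: packing_state_def)
    then have wh: "0 \<le> w" "0 \<le> h" by (auto simp: A')
    have "rect_area A = min w h * max w h"
      by (simp add: A' min_def max_def)
    also have "\<dots> = min w h powr t * min w h powr (1 - t) * max w h"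
      using wh by (simp flip: powr_add)
    also have "\<dots> \<le> c * min w h powr (1 - t) * max w h"
      unfolding c_def using wh t neg A unfolding A' n_def
      by (intro mult_right_mono powr_mono2) (auto simp: not_le min_less_iff_disj intro!: less_imp_le)
    finally show ?thesis by (simp add: A' mult_ac)
  qed
  then have "tail_area n \<le> sum_list (map (\<lambda>A. c * weighted_perimeter (1 - t) A) R)"
    using assms unfolding packing_state_def n_def by (metis sum_list_mono)
  also have "\<dots> = c * sum_list (map (weighted_perimeter (1 - t)) R)"
    by (simp add: sum_list_const_mult)
  also have "\<dots> \<le> c * perimeter_bound n"
    using assms unfolding packing_state_def n_def c_def by (intro mult_left_mono) auto
  also have "\<dots> = (real M powr t * real M powr - t) * (z n powr (- t * t) * z n powr (1 - t)\<^sup>2) / (2 * (2 * t - 1))"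
    using M z by (simp add: c_def perimeter_bound_def side_def powr_mult powr_powr)
  also have "real M powr t * real M powr - t = 1"
    using M by (simp flip: powr_add)
  also have "z n powr (- t * t) * z n powr (1 - t)\<^sup>2 = z n powr - (2 * t - 1)"
    by (simp add: power2_eq_square algebra_simps flip: powr_add)
  also have "1 * z n powr - (2 * t - 1) / (2 * (2 * t - 1)) < z n powr - (2 * t - 1) / (2 * t - 1)"
    using z t by (simp add: field_simps)
  also have "\<dots> \<le> tail_area n"
    by (intro tail_area_bounds) (simp add: n_def)
  finally show False by simp
qed

lemma packing_state_step:
  assumes state: "packing_state l N S R"
  shows "\<exists>N' S' R'. packing_state l N' (S @ S') R' \<and> N < N'"
proof -
  define n where "n = n\<^sub>0 + N"
  define s where "s = side n"
  define T where "T = 2 * t - 1"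
  obtain x y w h where R: "(x, y, w, h) \<in> set R" and wide: "real M * s \<le> min w h"
    using exists_wide_rect[OF state] by (auto simp: s_def n_def)
  then obtain R1 R2 where R12: "R = R1 @ (x, y, w, h) # R2"
    by (meson split_list)
  define k where "k = nat \<lfloor>min w h / s\<rfloor>"
  define \<theta> where "\<theta> = real k * (real M)\<^sup>2 / z n"
  have n: "n\<^sub>0 \<le> n" by (simp add: n_def)
  have z: "1 \<le> z n" and s: "0 < s" and T: "0 < T"
    using z_ge_1 side_pos n t by (auto simp: s_def T_def)
  have wh: "0 < min w h"
    using wide s M by (smt (verit) mult_pos_pos of_nat_0_less_iff not_one_le_zero gr0I)
  have k1: "1 \<le> k"
  proof -
    have "real M \<le> min w h / s" using wide s by (simp add: field_simps)
    then have "M \<le> k" unfolding k_def by (rule le_nat_floor)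
    then show ?thesis using M by simp
  qed
  \<comment> \<open>A square of side \<open>k * s\<close> fits into the chosen rectangle, whose area
    is at most the tail, itself at most \<open>2 * z n * s\<^sup>2 / T\<close>. Hence
    \<open>k\<close> is of order the square root of \<open>z n\<close>, which makes both
    \<open>k * M / z n\<close> and \<theta> small for large \<open>n\<^sub>0\<close>.\<close>
  have k_sq: "(real k)\<^sup>2 \<le> 2 * z n / T"
  proof -
    have "real k = of_int \<lfloor>min w h / s\<rfloor>"
      unfolding k_def using wh s by (simp add: zero_le_divide_iff)
    then have "real k \<le> min w h / s"
      by linarith
    then have "real k * s \<le> min w h"
      using s by (simp only: pos_le_divide_eq)
    then have "(real k * s)\<^sup>2 \<le> (min w h)\<^sup>2"
      using s by (intro power_mono) auto
    also have "\<dots> \<le> rect_area (x, y, w, h)"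
      using wh by (auto simp: power2_eq_square min_def intro: mult_left_mono mult_right_mono)
    also have "\<dots> \<le> tail_area n"
    proof -
      have "0 \<le> rect_area A" if "A \<in> set R" for A
        using that state by (auto simp: packing_state_def intro: rect_area_nonneg)
      then show ?thesis
        using state R member_le_sum_list_map[of R rect_area "(x, y, w, h)"] by (simp add: packing_state_def n_def)
    qed
    also have "\<dots> \<le> 2 * z n powr - T / T"
      using tail_area_bounds(2)[OF n] by (simp add: T_def)
    also have "z n powr - T = z n * s\<^sup>2"
      using z powr_sub_one[of "z n" "- T"] unfolding s_def side_square by (simp add: T_def)
    finally have "(real k)\<^sup>2 * s\<^sup>2 \<le> 2 * z n / T * s\<^sup>2"
      by (simp add: power_mult_distrib mult_ac)
    then show ?thesis
      by (rule mult_right_le_imp_le) (use s in simp)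
  qed
  have kM: "real k * real M \<le> z n"
  proof (rule power2_le_imp_le)
    have "(real k * real M)\<^sup>2 \<le> 2 * z n / T * (real M)\<^sup>2"
      unfolding power_mult_distrib using k_sq by (intro mult_right_mono) auto
    also have "\<dots> = z n * (2 * (real M)\<^sup>2) / T" by simp
    also have "\<dots> \<le> z n * (z n * T) / T"
      using z_ge(2)[OF n] z T by (intro divide_right_mono mult_left_mono) (auto simp: T_def)
    finally show "(real k * real M)\<^sup>2 \<le> (z n)\<^sup>2"
      using T by (simp add: power2_eq_square)
  qed (use z in auto)
  \<comment> \<open>After squaring, \<theta> contributes at most
    \<open>2 * M ^ 4 / (z n * T)\<close>, so the left side is at most
    \<open>3200 * M ^ 4 / z n\<close>.\<close>
  have \<theta>: "40 * \<theta> * sqrt T \<le> 1"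
  proof (rule power2_le_imp_le)
    have "(40 * \<theta> * sqrt T)\<^sup>2 = 1600 * T * (real M ^ 4 / (z n)\<^sup>2) * (real k)\<^sup>2"
      using T by (simp add: \<theta>_def power_mult_distrib power_divide flip: power_mult)
    also have "\<dots> \<le> 1600 * T * (real M ^ 4 / (z n)\<^sup>2) * (2 * z n / T)"
      using k_sq T by (intro mult_left_mono) auto
    also have "\<dots> = 3200 * real M ^ 4 / z n"
      using T z by (simp add: power2_eq_square)
    also have "\<dots> \<le> 1"
      using z_ge(1)[OF n] z by simp
    finally show "(40 * \<theta> * sqrt T)\<^sup>2 \<le> 1\<^sup>2" by simp
  qed auto
  have "\<exists>S T. length S = k * M \<and> (\<forall>p<k * M. \<exists>x y. S ! p = (x, y, side (n + p), side (n + p))) \<and>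
    sorted_wrt non_overlapping (S @ T) \<and> (\<forall>A\<in>set (S @ T). subrect A (x, y, w, h)) \<and>
    sum_list (map rect_area (S @ T)) = w * h \<and>
    sum_list (map (weighted_perimeter (1 - t)) T) \<le> weighted_perimeter (1 - t) (x, y, w, h) +
      real k * (s powr (1 - t) * s) * (8 + 5 * (real k * (real M)\<^sup>2 / z n))"
  proof (rule pack_rect)
    show "real M ^ 3 \<le> z n" using M_pow_le_z[OF n, of 3] zero_le_power[of "real M" 3] by linarith
    show "side (n + p) - side (n + (p + d)) \<le> real d * (s / z n)" for p d
      unfolding s_def by (rule side_diff[OF n])
  qed (use t s kM M side_pos side_anti wide n in \<open>auto simp: k_def s_def\<close>)
  then obtain S' T' where S': "length S' = k * M"
      "\<forall>p<k * M. \<exists>x y. S' ! p = (x, y, side (n + p), side (n + p))"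
    and disj: "sorted_wrt non_overlapping (S' @ T')" and sub: "\<forall>A\<in>set (S' @ T'). subrect A (x, y, w, h)"
    and area: "sum_list (map rect_area (S' @ T')) = w * h"
    and perim: "sum_list (map (weighted_perimeter (1 - t)) T') \<le> weighted_perimeter (1 - t) (x, y, w, h) +
      real k * (s powr (1 - t) * s) * (8 + 5 * \<theta>)"
    unfolding \<theta>_def by blast
  define N' where "N' = N + k * M"
  have "packing_state l N' (S @ S') (R1 @ T' @ R2)"
    unfolding packing_state_def
  proof (intro conjI)
    show "length (S @ S') = N'"
      using state S' by (simp add: N'_def packing_state_def)
    show "\<forall>p<N'. \<exists>x y. (S @ S') ! p = (x, y, side (n\<^sub>0 + p), side (n\<^sub>0 + p))"
    proof (intro allI impI)
      fix p assume p: "p < N'"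
      show "\<exists>x y. (S @ S') ! p = (x, y, side (n\<^sub>0 + p), side (n\<^sub>0 + p))"
      proof (cases "p < N")
        case True
        then show ?thesis using state by (auto simp: packing_state_def nth_append)
      next
        case False
        then have "p - N < k * M" "n + (p - N) = n\<^sub>0 + p" using p by (auto simp: N'_def n_def)
        then show ?thesis using S'(2) False state by (auto simp: packing_state_def nth_append)
      qed
    qed
    have in_sq: "subrect A (0, 0, l, l)" if "A \<in> set (S @ R)" for A
      using that state by (auto simp: packing_state_def)
    show "\<forall>A\<in>set ((S @ S') @ R1 @ T' @ R2). subrect A (0, 0, l, l)"
    proof
      fix A assume A: "A \<in> set ((S @ S') @ R1 @ T' @ R2)"
      show "subrect A (0, 0, l, l)"
      proof (cases "A \<in> set (S' @ T')")
        case True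
        have "(x, y, w, h) \<in> set (S @ R)" using R by simp
        then show ?thesis
          using True sub in_sq subrect_trans by blast
      next
        case False
        then have "A \<in> set (S @ R)" using A by (auto simp: R12)
        then show ?thesis by (rule in_sq)
      qed
    qed
    show "sorted_wrt non_overlapping ((S @ S') @ R1 @ T' @ R2)"
    proof -
      have refl: "subrect A A" if "A \<in> set (S @ R)" for A
        using in_sq[OF that] by (cases A) auto
      have old: "sorted_wrt non_overlapping (S @ R1 @ (x, y, w, h) # R2)"
        using state by (simp add: packing_state_def R12)
      have "non_overlapping A B" "non_overlapping B A"
        if "A \<in> set (S @ R1 @ R2)" "B \<in> set (S' @ T')" for A B
      proof -
        have "non_overlapping A (x, y, w, h)"
          using old that(1)
          by (auto simp: sorted_wrt_append simp del: non_overlapping.simps intro: non_overlapping_sym)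
        moreover have "A \<in> set (S @ R)" using that(1) by (auto simp: R12)
        ultimately show "non_overlapping A B"
          using refl that(2) sub non_overlapping_subrect by blast
        then show "non_overlapping B A" by (rule non_overlapping_sym)
      qed
      then show ?thesis
        using old disj by (auto simp: sorted_wrt_append simp del: non_overlapping.simps)
    qed
    show "sum_list (map rect_area (R1 @ T' @ R2)) = tail_area (n\<^sub>0 + N')"
    proof -
      have "map rect_area S' = map (\<lambda>p. (side (n + p))\<^sup>2) [0..<k * M]"
        using S' by (intro nth_equalityI) (auto simp: power2_eq_square)
      then have "sum_list (map rect_area S') = (\<Sum>p<k * M. (side (n + p))\<^sup>2)"
        by (simp add: sum_list_distinct_conv_sum_set lessThan_atLeast0)
      moreover have "tail_area n = (\<Sum>p<k * M. (side (n + p))\<^sup>2) + tail_area (n + k * M)"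
        by (rule tail_area_split[OF n])
      moreover have "sum_list (map rect_area R1) + w * h + sum_list (map rect_area R2) = tail_area n"
        using state by (simp add: packing_state_def R12 n_def)
      ultimately show ?thesis
        using area by (simp add: N'_def n_def add_ac)
    qed
    show "sum_list (map (weighted_perimeter (1 - t)) (R1 @ T' @ R2)) \<le> perimeter_bound (n\<^sub>0 + N')"
    proof -
      define G where "G = (1 - t)\<^sup>2 * real M powr (1 - t)"
      define E where "E = s powr (1 - t) * s"
      \<comment> \<open>Up to the factor \<open>(1 - t)\<^sup>2\<close> this is the derivative of
        \<open>z powr (1 - t)\<^sup>2\<close> at \<open>z n\<close>, so cost and growth of the bound
        are compared at equal powers of \<open>z n\<close>. The 4 below collects the 2 in the
        denominator of \<open>perimeter_bound\<close> and the 2 lost in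
        \<open>powr_add_diff_ge\<close>.\<close>
      have E: "E = z n powr ((1 - t)\<^sup>2 - 1)"
        using z by (simp add: E_def s_def side_def powr_powr power2_eq_square algebra_simps flip: powr_add)
      have "(8 + 5 * \<theta>) * (4 * T) \<le> G"
      proof -
        have "40 * \<theta> * T = 40 * \<theta> * sqrt T * sqrt T" using T by simp
        also have "\<dots> \<le> 1 * sqrt T" using \<theta> T by (intro mult_right_mono) auto
        also have "\<dots> \<le> G" using M_large(2) by (simp add: T_def G_def)
        finally have "20 * \<theta> * T \<le> G / 2" by simp
        moreover have "32 * T \<le> G / 2" using M_large(1) by (simp add: T_def G_def)
        ultimately show ?thesis by (simp add: algebra_simps)
      qed
      then have "8 + 5 * \<theta> \<le> G / (4 * T)"
        using T by (simp add: pos_le_divide_eq)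
      then have "real k * E * (8 + 5 * \<theta>) \<le> real k * E * (G / (4 * T))"
        using s by (intro mult_left_mono) (auto simp: E_def)
      also have "\<dots> = real M powr - t / (2 * T) * ((1 - t)\<^sup>2 * (real k * real M) * E / 2)"
        using M T unfolding G_def by (simp add: powr_diff powr_minus field_simps)
      also have "\<dots> \<le> real M powr - t / (2 * T) * ((z n + real k * real M) powr (1 - t)\<^sup>2 - z n powr (1 - t)\<^sup>2)"
        unfolding E using z kM k1 M T t
        by (intro mult_left_mono powr_add_diff_ge) (auto simp: power_le_one)
      also have "\<dots> = perimeter_bound (n + k * M) - perimeter_bound n"
        by (simp add: perimeter_bound_def T_def z_def add_ac right_diff_distrib)
      finally have "real k * E * (8 + 5 * \<theta>) \<le> perimeter_bound (n + k * M) - perimeter_bound n" .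
      moreover have "sum_list (map (weighted_perimeter (1 - t)) R1) + weighted_perimeter (1 - t) (x, y, w, h) +
          sum_list (map (weighted_perimeter (1 - t)) R2) \<le> perimeter_bound n"
        using state by (simp add: packing_state_def R12 n_def)
      ultimately show ?thesis
        using perim by (simp add: N'_def n_def E_def add_ac)
    qed
  qed
  moreover have "N < N'" using k1 M by (simp add: N'_def)
  ultimately show ?thesis by blast
qed

lemma exists_packing:
  assumes "0 < l" "l\<^sup>2 = tail_area n\<^sub>0"
  shows "\<exists>B. (\<forall>p. (\<exists>x y. B p = (x, y, side (n\<^sub>0 + p), side (n\<^sub>0 + p))) \<and> subrect (B p) (0, 0, l, l)) \<and>
    (\<forall>p p'. p \<noteq> p' \<longrightarrow> non_overlapping (B p) (B p'))"
proof -
  \<comment> \<open>Stage \<open>i\<close> holds at least \<open>i\<close> squares, so every square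
    is eventually placed, and each list extends the previous one, so a placed square never
    moves.\<close>
  have "\<exists>f. \<forall>i. (case f i of (N, S, R) \<Rightarrow> i \<le> N \<and> packing_state l N S R) \<and>
      (\<exists>U. fst (snd (f (Suc i))) = fst (snd (f i)) @ U)"
  proof (rule dependent_nat_choice)
    show "\<exists>v. case v of (N, S, R) \<Rightarrow> 0 \<le> N \<and> packing_state l N S R"
      using packing_state_initial[OF assms] by auto
  next
    fix v :: "nat \<times> rect list \<times> rect list" and i
    assume "case v of (N, S, R) \<Rightarrow> i \<le> N \<and> packing_state l N S R"
    then obtain N S R where v: "v = (N, S, R)" "i \<le> N" "packing_state l N S R"
      by (cases v) auto
    then obtain N' S' R' where "packing_state l N' (S @ S') R'" "N < N'"
      using packing_state_step by blast
    then show "\<exists>v'. (case v' of (N, S, R) \<Rightarrow> Suc i \<le> N \<and> packing_state l N S R) \<and>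
        (\<exists>U. fst (snd v') = fst (snd v) @ U)"
      using v by (intro exI[of _ "(N', S @ S', R')"]) auto
  qed
  then obtain f where f': "\<forall>i. (case f i of (N, S, R) \<Rightarrow> i \<le> N \<and> packing_state l N S R) \<and>
      (\<exists>U. fst (snd (f (Suc i))) = fst (snd (f i)) @ U)" ..
  have f: "case f i of (N, S, R) \<Rightarrow> i \<le> N \<and> packing_state l N S R"
    and ext: "\<exists>U. fst (snd (f (Suc i))) = fst (snd (f i)) @ U" for i
    using spec[OF f', of i] by (rule conjunct1, rule conjunct2)
  define S where "S i = fst (snd (f i))" for i
  have ext': "\<exists>U. S (i + d) = S i @ U" for i d
  proof (induction d)
    case (Suc d)
    then show ?case using ext[of "i + d"] by (auto simp: S_def)
  qed simp
  have len: "i \<le> length (S i)" for i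
    using f[of i] by (auto simp: S_def packing_state_def split: prod.splits)
  have side: "\<exists>x y. S i ! p = (x, y, side (n\<^sub>0 + p), side (n\<^sub>0 + p))" if "p < length (S i)" for i p
    using f[of i] that by (auto simp: S_def packing_state_def split: prod.splits)
  have inside: "subrect (S i ! p) (0, 0, l, l)" if "p < length (S i)" for i p
    using f[of i] that by (auto simp: S_def packing_state_def split: prod.splits)
  have disj: "non_overlapping (S i ! p) (S i ! p')" if "p < p'" "p' < length (S i)" for i p p'
    using f[of i] that
    by (auto simp: S_def packing_state_def sorted_wrt_append intro: sorted_wrt_nth_less split: prod.splits)
  \<comment> \<open>Stage \<open>Suc p\<close> is certain to contain entry \<open>p\<close>, and all
    later stages agree with it there.\<close>
  define B where "B p = S (Suc p) ! p" for p
  have stable: "B p = S i ! p" if "p < i" for p i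
    using ext'[of "Suc p" "i - Suc p"] len[of "Suc p"] that by (auto simp: B_def nth_append)
  have "non_overlapping (B p) (B p')" if "p < p'" for p p'
    using disj[OF that, of "Suc p'"] len[of "Suc p'"] that stable[of p "Suc p'"] stable[of p' "Suc p'"] by auto
  then have "non_overlapping (B p) (B p')" if "p \<noteq> p'" for p p'
    using that non_overlapping_sym by (metis linorder_neqE_nat)
  moreover have "(\<exists>x y. B p = (x, y, side (n\<^sub>0 + p), side (n\<^sub>0 + p))) \<and> subrect (B p) (0, 0, l, l)" for p
    using side[of p "Suc p"] inside[of p "Suc p"] len[of "Suc p"] by (auto simp: B_def)
  ultimately show ?thesis by blast
qed

end

section \<open>Rotated squares, Lebesgue measure and perfection\<close>

text \<open>Orthonormality of \<open>u\<close> and \<open>v\<close> makes \<open>f\<close> an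
  orthogonal transformation, so the square inherits compactness, convexity and area from an
  axis-parallel box.\<close>

lemma square_of_side_measure:
  assumes "square_of_side s Q"
  shows "compact Q" "convex Q" "measure lebesgue Q = s\<^sup>2"
proof -
  obtain p u v where uv: "s > 0" "norm u = 1" "norm v = 1" "u \<bullet> v = 0"
    and Q: "Q = {p + a *\<^sub>R u + b *\<^sub>R v | a b. a \<in> {0..s} \<and> b \<in> {0..s}}"
    using assms unfolding square_of_side_def by auto
  define f :: "real^2 \<Rightarrow> real^2" where "f z = (z $ 1) *\<^sub>R u + (z $ 2) *\<^sub>R v" for z
  have lin: "linear f"
    by (rule linearI) (simp_all add: f_def algebra_simps)
  have "u \<bullet> u = 1" "v \<bullet> v = 1" "v \<bullet> u = 0"
    using uv by (simp_all add: dot_square_norm inner_commute)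
  then have "f z \<bullet> f w = z $ 1 * w $ 1 + z $ 2 * w $ 2" for z w
    using uv(4) by (simp add: f_def inner_add_left inner_add_right)
  then have orth: "orthogonal_transformation f"
    unfolding orthogonal_transformation_def using lin by (simp add: inner_vec_def sum_2)
  have Q': "Q = (+) p ` f ` cbox 0 (vec s)"
  proof (intro subset_antisym subsetI)
    fix z assume "z \<in> Q"
    then obtain a b where "z = p + a *\<^sub>R u + b *\<^sub>R v" "a \<in> {0..s}" "b \<in> {0..s}"
      unfolding Q by auto
    then show "z \<in> (+) p ` f ` cbox 0 (vec s)"
      by (intro image_eqI[of _ _ "f (vector [a, b])"] image_eqI[of _ _ "vector [a, b]"])
         (auto simp: f_def mem_box_cart forall_2 add.assoc)
  qed (force simp: Q f_def mem_box_cart forall_2 add.assoc)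
  show "compact Q"
    unfolding Q' using lin
    by (intro compact_translation compact_continuous_image linear_continuous_on compact_cbox)
       (simp add: linear_conv_bounded_linear)
  show "convex Q"
    unfolding Q' using lin by (intro convex_translation convex_linear_image convex_box)
  have "0 \<in> cbox 0 (vec s :: real^2)"
    using uv by (simp add: mem_box_cart)
  then show "measure lebesgue Q = s\<^sup>2"
    unfolding Q' measure_translation
    by (subst measure_orthogonal_image[OF orth])
       (auto simp: content_cbox_if_cart prod_2 power2_eq_square)
qed

lemma disjoint_interiors_of_separated:
  fixes A B :: "'a::euclidean_space set"
  assumes "u \<noteq> 0" "\<And>z. z \<in> A \<Longrightarrow> u \<bullet> z \<le> \<beta>" "\<And>z. z \<in> B \<Longrightarrow> \<beta> \<le> u \<bullet> z"
  shows "interior A \<inter> interior B = {}"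
proof -
  have "interior A \<subseteq> interior {z. u \<bullet> z \<le> \<beta>}" "interior B \<subseteq> interior {z. u \<bullet> z \<ge> \<beta>}"
    using assms(2,3) by (auto intro!: interior_mono)
  then show ?thesis
    using assms(1) by (fastforce simp: interior_halfspace_le interior_halfspace_ge)
qed

text \<open>Closed squares may share boundary points, so countable additivity is applied to their
  interiors; no area is lost, as a bounded convex set has a null frontier.\<close>

lemma perfectly_packed_if_measure:
  assumes packed: "packed_into Q {n\<^sub>0..} \<Omega>" and \<Omega>: "\<Omega> \<in> lmeasurable"
    and Q: "\<And>n. n\<^sub>0 \<le> n \<Longrightarrow> square_of_side (s n) (Q n)"
    and area: "(\<lambda>i. (s (n\<^sub>0 + i))\<^sup>2) sums measure lebesgue \<Omega>"
  shows "perfectly_packed_into Q {n\<^sub>0..} \<Omega>"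
proof -
  define P where "P i = interior (Q (n\<^sub>0 + i))" for i
  have P: "P i \<in> lmeasurable" "measure lebesgue (P i) = (s (n\<^sub>0 + i))\<^sup>2" for i
  proof -
    note sq = square_of_side_measure[OF Q[OF le_add1[of n\<^sub>0 i]]]
    have "bounded (Q (n\<^sub>0 + i))" using sq by (simp add: compact_imp_bounded)
    then show "P i \<in> lmeasurable"
      unfolding P_def by (intro lmeasurable_open bounded_subset[OF _ interior_subset] open_interior)
    show "measure lebesgue (P i) = (s (n\<^sub>0 + i))\<^sup>2"
      unfolding P_def
      using measure_interior[OF \<open>bounded (Q (n\<^sub>0 + i))\<close> negligible_convex_frontier] sq by metis
  qed
  have "P i \<subseteq> Q (n\<^sub>0 + i)" for i
    unfolding P_def by (rule interior_subset)
  then have sub: "(\<Union>i. P i) \<subseteq> (\<Union>n\<in>{n\<^sub>0..}. Q n)" "(\<Union>n\<in>{n\<^sub>0..}. Q n) \<subseteq> \<Omega>"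
    using packed by (fastforce, auto simp: packed_into_def)
  have disj: "disjoint_family P"
    using packed unfolding packed_into_def disjoint_family_on_def P_def by auto
  have meas: "(\<Union>i. P i) \<in> sets lebesgue"
    using P by (intro sets.countable_UN) (auto simp: fmeasurableD)
  then have lmeas: "(\<Union>i. P i) \<in> lmeasurable"
    using sub \<Omega> by (intro fmeasurableI2[OF \<Omega>]) auto
  have "(\<lambda>i. measure lebesgue (P i)) sums measure lebesgue (\<Union>i. P i)"
    using P disj fmeasurableD2[OF lmeas] by (intro measure_UNION) (auto simp: fmeasurableD)
  then have "measure lebesgue (\<Union>i. P i) = measure lebesgue \<Omega>"
    using area P sums_unique2 by auto
  then have "measure lebesgue (\<Omega> - (\<Union>i. P i)) = 0"
    using measurable_measure_Diff[OF \<Omega> meas] sub by auto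
  then have "negligible (\<Omega> - (\<Union>i. P i))"
    using \<Omega> meas by (subst negligible_iff_measure) (auto intro: fmeasurable.Diff fmeasurable_Diff)
  then have "negligible (\<Omega> - (\<Union>n\<in>{n\<^sub>0..}. Q n))"
    using sub by (elim negligible_subset) auto
  then show ?thesis
    using packed by (simp add: perfectly_packed_into_def)
qed

text \<open>The rectangles are dilated by \<open>c\<close> and placed in the frame of the given,
  possibly rotated, square. A separating coordinate line becomes a hyperplane orthogonal to
  \<open>u\<close> or \<open>v\<close>.\<close>

lemma can_pack_perfectly_of_rects:
  fixes B :: "nat \<Rightarrow> rect"
  assumes c: "0 < c" and \<sigma>: "\<And>i. 0 < \<sigma> i" "\<And>i. s (n\<^sub>0 + i) = c * \<sigma> i"
    and B: "\<And>i. \<exists>x y. B i = (x, y, \<sigma> i, \<sigma> i)" "\<And>i. subrect (B i) (0, 0, l, l)"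
      "\<And>i j. i \<noteq> j \<Longrightarrow> non_overlapping (B i) (B j)"
    and \<Omega>: "square_of_side (c * l) \<Omega>"
    and area: "(\<lambda>i. (s (n\<^sub>0 + i))\<^sup>2) sums measure lebesgue \<Omega>"
  shows "can_pack_perfectly s n\<^sub>0 \<Omega>"
proof -
  obtain p u v where uv: "norm u = 1" "norm v = 1" "u \<bullet> v = 0"
    and \<Omega>_eq: "\<Omega> = {p + a *\<^sub>R u + b *\<^sub>R v | a b. a \<in> {0..c * l} \<and> b \<in> {0..c * l}}"
    using \<Omega> unfolding square_of_side_def by auto
  obtain x y where xy: "\<And>i. B i = (x i, y i, \<sigma> i, \<sigma> i)"
    using B(1) by metis
  define Q where "Q n = {(p + (c * x (n - n\<^sub>0)) *\<^sub>R u + (c * y (n - n\<^sub>0)) *\<^sub>R v) + a *\<^sub>R u + b *\<^sub>R v | a b.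
    a \<in> {0..s n} \<and> b \<in> {0..s n}}" for n
  have s: "s n = c * \<sigma> (n - n\<^sub>0)" if "n\<^sub>0 \<le> n" for n
    using \<sigma>(2)[of "n - n\<^sub>0"] that by simp
  have sq: "square_of_side (s n) (Q n)" if "n\<^sub>0 \<le> n" for n
    unfolding square_of_side_def Q_def using s[OF that] c \<sigma>(1) uv by auto
  have Q_sub: "Q n \<subseteq> \<Omega>" if "n\<^sub>0 \<le> n" for n
  proof
    fix z assume "z \<in> Q n"
    then obtain a b where z: "z = (p + (c * x (n - n\<^sub>0)) *\<^sub>R u + (c * y (n - n\<^sub>0)) *\<^sub>R v) + a *\<^sub>R u + b *\<^sub>R v"
      "a \<in> {0..s n}" "b \<in> {0..s n}"
      unfolding Q_def by auto
    have "0 \<le> x (n - n\<^sub>0)" "x (n - n\<^sub>0) + \<sigma> (n - n\<^sub>0) \<le> l" "0 \<le> y (n - n\<^sub>0)" "y (n - n\<^sub>0) + \<sigma> (n - n\<^sub>0) \<le> l"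
      using B(2)[of "n - n\<^sub>0"] by (simp_all add: xy)
    then have "0 \<le> c * x (n - n\<^sub>0)" "c * x (n - n\<^sub>0) + s n \<le> c * l"
      "0 \<le> c * y (n - n\<^sub>0)" "c * y (n - n\<^sub>0) + s n \<le> c * l"
      using c unfolding s[OF that] by (simp_all flip: distrib_left)
    then show "z \<in> \<Omega>"
      unfolding \<Omega>_eq using z
      by (intro CollectI exI[of _ "c * x (n - n\<^sub>0) + a"] exI[of _ "c * y (n - n\<^sub>0) + b"])
         (auto simp: algebra_simps)
  qed
  have coords: "u \<bullet> p + c * x (n - n\<^sub>0) \<le> u \<bullet> z" "u \<bullet> z \<le> u \<bullet> p + c * (x (n - n\<^sub>0) + \<sigma> (n - n\<^sub>0))"
    "v \<bullet> p + c * y (n - n\<^sub>0) \<le> v \<bullet> z" "v \<bullet> z \<le> v \<bullet> p + c * (y (n - n\<^sub>0) + \<sigma> (n - n\<^sub>0))"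
    if "z \<in> Q n" "n\<^sub>0 \<le> n" for z n
  proof -
    have "u \<bullet> u = 1" "v \<bullet> v = 1" "v \<bullet> u = 0"
      using uv by (simp_all add: dot_square_norm inner_commute)
    then show "u \<bullet> p + c * x (n - n\<^sub>0) \<le> u \<bullet> z" "u \<bullet> z \<le> u \<bullet> p + c * (x (n - n\<^sub>0) + \<sigma> (n - n\<^sub>0))"
      "v \<bullet> p + c * y (n - n\<^sub>0) \<le> v \<bullet> z" "v \<bullet> z \<le> v \<bullet> p + c * (y (n - n\<^sub>0) + \<sigma> (n - n\<^sub>0))"
      using that uv(3) by (auto simp: Q_def s inner_add_right algebra_simps)
  qed
  have disj: "interior (Q m) \<inter> interior (Q n) = {}" if "m \<noteq> n" "n\<^sub>0 \<le> m" "n\<^sub>0 \<le> n" for m n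
  proof -
    have sep: "interior (Q m) \<inter> interior (Q n) = {}"
      if mn: "n\<^sub>0 \<le> m" "n\<^sub>0 \<le> n" and le: "x (m - n\<^sub>0) + \<sigma> (m - n\<^sub>0) \<le> x (n - n\<^sub>0) \<or>
          y (m - n\<^sub>0) + \<sigma> (m - n\<^sub>0) \<le> y (n - n\<^sub>0)" for m n
      using le
    proof
      assume "x (m - n\<^sub>0) + \<sigma> (m - n\<^sub>0) \<le> x (n - n\<^sub>0)"
      then have "c * (x (m - n\<^sub>0) + \<sigma> (m - n\<^sub>0)) \<le> c * x (n - n\<^sub>0)"
        using c by (intro mult_left_mono) auto
      then show ?thesis
        using coords(1)[OF _ mn(2)] coords(2)[OF _ mn(1)] uv
        by (intro disjoint_interiors_of_separated[of u _ "u \<bullet> p + c * x (n - n\<^sub>0)"]) force+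
    next
      assume "y (m - n\<^sub>0) + \<sigma> (m - n\<^sub>0) \<le> y (n - n\<^sub>0)"
      then have "c * (y (m - n\<^sub>0) + \<sigma> (m - n\<^sub>0)) \<le> c * y (n - n\<^sub>0)"
        using c by (intro mult_left_mono) auto
      then show ?thesis
        using coords(3)[OF _ mn(2)] coords(4)[OF _ mn(1)] uv
        by (intro disjoint_interiors_of_separated[of v _ "v \<bullet> p + c * y (n - n\<^sub>0)"]) force+
    qed
    have "m - n\<^sub>0 \<noteq> n - n\<^sub>0" using that by simp
    from B(3)[OF this] show ?thesis
      using sep[of m n] sep[of n m] that by (auto simp: xy Int_commute)
  qed
  have "packed_into Q {n\<^sub>0..} \<Omega>"
    unfolding packed_into_def disjoint_family_on_def planar_square_def
    using sq Q_sub disj by auto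
  then have "perfectly_packed_into Q {n\<^sub>0..} \<Omega>"
    using square_of_side_measure(1)[OF \<Omega>] sq area
    by (intro perfectly_packed_if_measure[where s = s]) (auto intro: lmeasurable_compact)
  then show ?thesis
    unfolding can_pack_perfectly_def using sq by blast
qed

section \<open>From the numerical hypotheses to the conditions of the induction\<close>

text \<open>\<open>G\<close> will be \<open>M powr (1 - t)\<close>. For the second claim put
  \<open>T = 2 * t - 1\<close>: if \<open>T \<ge> 1 / 16\<close> then
  \<open>sqrt T \<le> 4 * T\<close> and the first claim applies; otherwise
  \<open>1 - t > 15 / 32\<close> and \<open>G \<ge> 2500\<close> alone suffices.\<close>

lemma M_large_sufficient:
  fixes t G :: real
  assumes t: "1/2 < t" "t < 1" and G: "2500 \<le> G" "4 * (2 * (2 * t - 1) / (1 - t)\<^sup>2) powr (2 / t) \<le> G"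
  shows "64 * (2 * t - 1) \<le> (1 - t)\<^sup>2 * G" and "sqrt (2 * t - 1) \<le> (1 - t)\<^sup>2 * G"
proof -
  define x where "x = 2 * (2 * t - 1) / (1 - t)\<^sup>2"
  have x: "0 < x" "64 * (2 * t - 1) = (1 - t)\<^sup>2 * (32 * x)"
    using t by (auto simp: x_def)
  \<comment> \<open>78 is the largest integer whose product with 32 is at most 2500. Beyond it the
    power of \<open>x\<close> takes over, its exponent \<open>2 / t\<close> being at least
    2.\<close>
  have "32 * x \<le> G"
  proof (cases "x \<le> 78")
    case True
    then show ?thesis using G(1) by simp
  next
    case False
    then have "78 * x \<le> x * x" by (intro mult_right_mono) auto
    also have "x * x = x powr 2" using False by (simp add: power2_eq_square)
    also have "\<dots> \<le> x powr (2 / t)" using False t by (intro powr_mono) (auto simp: field_simps)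
    finally show ?thesis using G(2) x unfolding x_def[symmetric] by simp
  qed
  then show 1: "64 * (2 * t - 1) \<le> (1 - t)\<^sup>2 * G"
    unfolding x(2) by (intro mult_left_mono) auto
  show "sqrt (2 * t - 1) \<le> (1 - t)\<^sup>2 * G"
  proof (cases "1 / 16 \<le> 2 * t - 1")
    case True
    then have "1 / 4 \<le> sqrt (2 * t - 1)"
      by (intro real_le_rsqrt) (simp add: power2_eq_square)
    then have "sqrt (2 * t - 1) * (1 / 4) \<le> sqrt (2 * t - 1) * sqrt (2 * t - 1)"
      using t by (intro mult_left_mono) auto
    then show ?thesis using 1 t by simp
  next
    case False
    then have "(15 / 32)\<^sup>2 * 2500 \<le> (1 - t)\<^sup>2 * G"
      using G t by (intro mult_mono power_mono) auto
    moreover have "sqrt (2 * t - 1) \<le> 1" using t by simp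
    moreover have "(1 :: real) \<le> (15 / 32)\<^sup>2 * 2500" by (simp add: power2_eq_square)
    ultimately show ?thesis by linarith
  qed
qed

text \<open>The fourth power of \<open>m\<close> suffices unless \<open>2 * t - 1 < 1 / m\<close>.
  Then t is so close to 1/2 that the second bound is at least of order
  \<open>(m / (2 * t - 1))\<^sup>2\<close>, which compensates for the small factor on the
  right.\<close>

lemma n\<^sub>0_large_sufficient:
  fixes t n m :: real
  assumes t: "1/2 < t" "t < 1" and m: "2500 \<le> m" and n: "4752 * m ^ 4 \<le> n"
    "(2 * (1 - t)\<^sup>2) powr (2 / t) * (2 / (2 * t - 1)) powr ((2 - t) / t) * m powr ((1 + t) / t) \<le> n"
  shows "2 * m\<^sup>2 \<le> n * (2 * t - 1)"
proof (cases "1 \<le> m * (2 * t - 1)")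
  case True
  have "2 * m\<^sup>2 * 1 \<le> 4752 * m ^ 3 * (m * (2 * t - 1))"
    using m True power_increasing[of 2 3 m] by (intro mult_mono) auto
  also have "\<dots> = 4752 * m ^ 4 * (2 * t - 1)"
    by (simp add: power3_eq_cube power4_eq_xxxx)
  also have "\<dots> \<le> n * (2 * t - 1)"
    using n t by (intro mult_right_mono) auto
  finally show ?thesis by simp
next
  case False
  define T where "T = 2 * t - 1"
  have "2500 * T \<le> m * T"
    using m t by (intro mult_right_mono) (auto simp: T_def)
  then have T: "0 < T" "T * m < 1" "T < 1 / 2500"
    using False t by (auto simp: T_def mult.commute)
  \<comment> \<open>Here \<open>1 - t > 49 / 100\<close>, so the base is at least 9/20, while the
    exponent \<open>2 / t\<close> is below 4; the fourth power of 9/20 just exceeds 1/25.\<close>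
  have "(9 / 20) powr 4 \<le> (9 / 20) powr (2 / t)"
    using t by (intro powr_mono') (auto simp: field_simps)
  also have "\<dots> \<le> (2 * (1 - t)\<^sup>2) powr (2 / t)"
  proof (intro powr_mono2)
    have "(49 / 100)\<^sup>2 \<le> (1 - t)\<^sup>2"
      using T(3) by (intro power_mono) (auto simp: T_def)
    then show "9 / 20 \<le> 2 * (1 - t)\<^sup>2" by (simp add: power2_eq_square)
  qed (use t in auto)
  finally have 1: "1 / 25 \<le> (2 * (1 - t)\<^sup>2) powr (2 / t)"
    by (simp add: powr_numeral power_divide)
  have "4 / T\<^sup>2 = (2 / T) powr 2"
    using T by (simp add: power_divide)
  also have "\<dots> \<le> (2 / T) powr ((2 - t) / t)"
    using T by (intro powr_mono) (auto simp: T_def field_simps)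
  finally have 2: "4 / T\<^sup>2 \<le> (2 / T) powr ((2 - t) / t)" .
  have "m\<^sup>2 = m powr 2"
    using m by simp
  also have "\<dots> \<le> m powr ((1 + t) / t)"
    using m t by (intro powr_mono) (auto simp: field_simps)
  finally have 3: "m\<^sup>2 \<le> m powr ((1 + t) / t)" .
  have "1 / 25 * (4 / T\<^sup>2) * m\<^sup>2 \<le> n"
    using mult_mono[OF mult_mono[OF 1 2] 3] n(2) by (simp add: T_def)
  then have "4 * m\<^sup>2 / (25 * T\<^sup>2) * T \<le> n * T"
    using T by (intro mult_right_mono) auto
  moreover have "2 * m\<^sup>2 * T \<le> 4 * m\<^sup>2 / 25"
    using T mult_right_mono[of T "2 / 25" "m\<^sup>2"] by simp
  then have "2 * m\<^sup>2 \<le> 4 * m\<^sup>2 / (25 * T\<^sup>2) * T"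
    using T by (simp add: field_simps power2_eq_square)
  ultimately show ?thesis by (simp add: T_def)
qed

text \<open>The exponents of \<open>q\<close> add up to
  \<open>- 1 + 2 / t - (2 - t) / t = 0\<close>. Thus this lower bound on the starting index survives
  the normalisation to q = 1.\<close>

lemma dilation_invariant_bound:
  fixes q g T t :: real
  assumes "0 < q" "0 < g" "0 < T" "0 < t"
  shows "inverse q * (2 * q * g) powr (2 / t) * (2 / (q * T)) powr ((2 - t) / t) =
    (2 * g) powr (2 / t) * (2 / T) powr ((2 - t) / t)"
proof -
  have "(2 * q * g) powr (2 / t) = q powr (2 / t) * (2 * g) powr (2 / t)"
    using assms powr_mult[of q "2 * g"] by (simp add: mult_ac)
  moreover have "(2 / (q * T)) powr ((2 - t) / t) = (2 / T) powr ((2 - t) / t) / q powr ((2 - t) / t)"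
    using assms powr_divide[of "2 / T" q] by (simp add: mult_ac)
  moreover have "q powr (2 / t) / q powr ((2 - t) / t) = q"
    using assms by (simp flip: powr_diff add: diff_divide_distrib)
  ultimately show ?thesis
    using assms by (simp add: field_simps)
qed

section \<open>Dilation to q = 1 and conclusion\<close>

theorem corollary3p1:
  fixes t q r \<delta> :: real and M N\<^sub>0 :: nat
  assumes t: "1/2 < t" "t < 1"
    and qr: "q > r" "r \<ge> 0"
    and \<delta>: "\<delta> = 1 - t"
    and pos: "M > 0" "N\<^sub>0 > 0"
    and M: "real M \<ge> Max {
        4 powr (1 / (1 - t)) * (2 * (2*t - 1) / (1 - t - \<delta>*t)) powr (2 / (t * (1 - t))),
        (50 * (11/10) powr (t * (2 - t))) powr (2 / (1 - t))}"
    and N\<^sub>0: "real N\<^sub>0 \<ge> Max {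
        4752 * real M ^ 4,
        2 * r / (q * ((264 * (real M)\<^sup>2) powr (1 / t) - 2)),
        (10 * q * (2*q) powr t * real M) powr (1 / (1 - t)),
        2 powr (1 / (1 - t - \<delta>*t)) * ((q + r) / q),
        inverse q * (q * (1 - t - \<delta>*t) / (q + r) powr (t + \<delta>*t)) powr (1 / (1 - t - \<delta>*t)),
        1 / (1 - 2 powr (- (1 / (2*t - 1)))),
        inverse q * (2 * q * (1 - t - \<delta>*t)) powr (2 / (1 - \<delta>))
          * (2 / (q * (2*t - 1))) powr ((1 + \<delta>) / (1 - \<delta>))
          * real M powr ((2 - \<delta>) / (1 - \<delta>)),
        inverse q * (2 / (q * (2*t - 1))) powr (1 / (2*t - 1))}"
  shows "\<forall>n\<^sub>0::nat. n\<^sub>0 > 0 \<longrightarrow> n\<^sub>0 \<ge> N\<^sub>0 \<longrightarrow>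
    (\<forall>\<Omega>. planar_square \<Omega> \<longrightarrow>
       measure lebesgue \<Omega> = (\<Sum>n. (q * real (n + n\<^sub>0) + r) powr (- 2 * t)) \<longrightarrow>
       can_pack_perfectly (\<lambda>n. (q * real n + r) powr (- t)) n\<^sub>0 \<Omega>)"
proof (intro allI impI)
  fix n\<^sub>0 :: nat and \<Omega> :: "(real^2) set"
  assume n\<^sub>0: "n\<^sub>0 > 0" "n\<^sub>0 \<ge> N\<^sub>0" and "planar_square \<Omega>"
    and area: "measure lebesgue \<Omega> = (\<Sum>n. (q * real (n + n\<^sub>0) + r) powr (- 2 * t))"
  then obtain L where L: "square_of_side L \<Omega>"
    by (auto simp: planar_square_def)
  have q: "0 < q" using qr by simp
  have \<gamma>: "1 - t - \<delta> * t = (1 - t)\<^sup>2"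
    by (simp add: \<delta> power2_eq_square algebra_simps)
  have M_ge: "4 powr (1 / (1 - t)) * (2 * (2 * t - 1) / (1 - t)\<^sup>2) powr (2 / (t * (1 - t))) \<le> real M"
    "(50 * (11 / 10) powr (t * (2 - t))) powr (2 / (1 - t)) \<le> real M"
    using M by (simp_all add: \<gamma>)
  define G where "G = real M powr (1 - t)"
  have G1: "4 * (2 * (2 * t - 1) / (1 - t)\<^sup>2) powr (2 / t) \<le> G"
  proof -
    have "(4 powr (1 / (1 - t)) * (2 * (2 * t - 1) / (1 - t)\<^sup>2) powr (2 / (t * (1 - t)))) powr (1 - t) \<le> G"
      unfolding G_def using M_ge(1) t by (intro powr_mono2) auto
    moreover have "1 / (1 - t) * (1 - t) = 1" "2 / (t * (1 - t)) * (1 - t) = 2 / t"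
      using t by (simp_all add: field_simps)
    ultimately show ?thesis
      using t by (simp add: powr_mult powr_powr del: times_divide_eq_left)
  qed
  have G2: "2500 \<le> G"
  proof -
    have "1 \<le> (11 / 10 :: real) powr (t * (2 - t))"
      using t by (intro ge_one_powr_ge_zero) auto
    then have "50 powr (2 / (1 - t)) \<le> (50 * (11 / 10) powr (t * (2 - t))) powr (2 / (1 - t))"
      using t by (intro powr_mono2) auto
    then have "(50 powr (2 / (1 - t))) powr (1 - t) \<le> G"
      unfolding G_def using M_ge(2) t by (intro powr_mono2) auto
    moreover have "2 / (1 - t) * (1 - t) = 2"
      using t by (simp add: field_simps)
    ultimately show ?thesis
      by (simp add: powr_powr del: times_divide_eq_left)
  qed
  have M2500: "2500 \<le> real M"
  proof -
    have "G \<le> real M powr 1"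
      unfolding G_def using t pos by (intro powr_mono) auto
    then show ?thesis using G2 pos by simp
  qed
  have N1: "4752 * real M ^ 4 \<le> real n\<^sub>0"
  proof -
    have "4752 * real M ^ 4 \<le> real N\<^sub>0"
      by (rule order_trans[OF Max_ge N\<^sub>0]) auto
    then show ?thesis using n\<^sub>0(2) by linarith
  qed
  have N7: "(2 * (1 - t)\<^sup>2) powr (2 / t) * (2 / (2 * t - 1)) powr ((2 - t) / t) *
      real M powr ((1 + t) / t) \<le> real n\<^sub>0"
  proof -
    have "inverse q * (2 * q * (1 - t - \<delta>*t)) powr (2 / (1 - \<delta>))
          * (2 / (q * (2*t - 1))) powr ((1 + \<delta>) / (1 - \<delta>))
          * real M powr ((2 - \<delta>) / (1 - \<delta>)) \<le> real N\<^sub>0"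
      by (rule order_trans[OF Max_ge N\<^sub>0]) auto
    moreover have "1 - \<delta> = t" "1 + \<delta> = 2 - t" "2 - \<delta> = 1 + t"
      by (auto simp: \<delta>)
    ultimately show ?thesis
      using n\<^sub>0(2) dilation_invariant_bound[of q "(1 - t)\<^sup>2" "2 * t - 1" t] q t
      unfolding \<gamma> by simp
  qed
  \<comment> \<open>Factoring out \<open>q\<close> gives \<open>q * n + r = q * (n + r / q)\<close>,
    so all squares are dilated by \<open>q powr - t\<close>; below, the given square of side
    \<open>L\<close> is matched with a normalised one of side \<open>L / c\<close>.\<close>
  interpret power_sidelengths t "r / q" M n\<^sub>0
  proof
    show "64 * (2 * t - 1) \<le> (1 - t)\<^sup>2 * real M powr (1 - t)"
      "sqrt (2 * t - 1) \<le> (1 - t)\<^sup>2 * real M powr (1 - t)"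
      using M_large_sufficient[OF t G2 G1] by (simp_all add: G_def)
    show "2 * (real M)\<^sup>2 \<le> real n\<^sub>0 * (2 * t - 1)"
      by (rule n\<^sub>0_large_sufficient[OF t M2500 N1 N7])
  qed (use t qr q pos N1 in auto)
  define c where "c = q powr - t"
  define s where "s n = (q * real n + r) powr - t" for n
  have c: "0 < c" using q by (simp add: c_def)
  have s_eq: "s n = c * side n" for n
  proof -
    have "q * real n + r = q * z n" using q by (simp add: z_def field_simps)
    then show ?thesis using q qr by (simp add: s_def c_def side_def z_def powr_mult)
  qed
  have "(\<lambda>i. c\<^sup>2 * (side (n\<^sub>0 + i))\<^sup>2) sums (c\<^sup>2 * tail_area n\<^sub>0)"
    unfolding tail_area_def by (intro sums_mult summable_sums tail_area_summable) simp
  then have sums: "(\<lambda>i. (s (n\<^sub>0 + i))\<^sup>2) sums (c\<^sup>2 * tail_area n\<^sub>0)"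
    by (simp add: s_eq power_mult_distrib)
  moreover have "(s (n\<^sub>0 + i))\<^sup>2 = (q * real (i + n\<^sub>0) + r) powr (- 2 * t)" for i
    by (simp add: s_def power2_eq_square add.commute flip: powr_add)
  ultimately have measure: "measure lebesgue \<Omega> = c\<^sup>2 * tail_area n\<^sub>0"
    unfolding area by (simp add: sums_iff)
  have "0 < L" using L by (simp add: square_of_side_def)
  moreover have "L\<^sup>2 = c\<^sup>2 * tail_area n\<^sub>0"
    using measure square_of_side_measure(3)[OF L] by simp
  ultimately have "0 < L / c" "(L / c)\<^sup>2 = tail_area n\<^sub>0"
    using c by (simp_all add: power_divide)
  from exists_packing[OF this] obtain B where
    B: "\<And>p. \<exists>x y. B p = (x, y, side (n\<^sub>0 + p), side (n\<^sub>0 + p))" "\<And>p. subrect (B p) (0, 0, L / c, L / c)"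
      "\<And>p p'. p \<noteq> p' \<Longrightarrow> non_overlapping (B p) (B p')"
    by blast
  have "can_pack_perfectly s n\<^sub>0 \<Omega>"
  proof (rule can_pack_perfectly_of_rects[OF c _ _ B])
    show "square_of_side (c * (L / c)) \<Omega>" using L c by simp
    show "(\<lambda>i. (s (n\<^sub>0 + i))\<^sup>2) sums measure lebesgue \<Omega>" unfolding measure by (rule sums)
  qed (auto simp: s_eq side_pos)
  then show "can_pack_perfectly (\<lambda>n. (q * real n + r) powr (- t)) n\<^sub>0 \<Omega>"
    by (simp add: s_def[abs_def])
qed

end
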